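(* The following holds constructively, that is, without the law of excluded middle and without any form of the axiom of choice. Let $\mathbb{R}$ denote the set of MacNeille real numbers, and let $f : \mathbb{N} \to \mathbb{R}$ be a map. Then there is a number $x_0 \in \mathbb{R}$ such that for no $n_0 \in \mathbb{N}$, $f(n_0) = x_0$.
   Context: Setting: the ambient mathematics is (impredicative) constructive mathematics, i.e. the kind of mathematics which can be carried out in any topos (with natural numbers object) or formalized in Intuitionistic Zermelo--Fraenkel set theory. Powersets are available, but neither the law of excluded middle nor any form of the axiom of choice may be used. "For no $n_0 \in \mathbb{N}$, $f(n_0) = x_0$" means $\neg \exists n_0 \in \mathbb{N}.\ f(n_0) = x_0$. MacNeille reals: a MacNeille real is a pair $x = (L, U)$ of inhabited subsets of $\mathbb{Q}$ such that for all $p \in \mathbb{Q}$, $p \in L$ if and only if there exists $q \in \mathbb{Q}$ with $q > p$ and $q \notin U$; and for all $q \in \mathbb{Q}$, $q \in U$ if and only if there exists $p \in \mathbb{Q}$ with $p < q$ and $p \notin L$. Two MacNeille reals are equal if and only if their components are equal as subsets of $\mathbb{Q}$. In classical mathematics the MacNeille reals coincide with the Dedekind reals and the Cauchy reals, but constructively these might differ. The MacNeille reals are constructively conditionally order complete: every inhabited subset which is bounded from above has a supremum, with respect to the order $(L,U) \leq (L',U')$ if and only if $L \subseteq L'$ (equivalently $U' \subseteq U$). *)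

theory Defs
  imports Main
begin

text \<open>
  "Holds constructively" is rendered as derivability in intuitionistic higher-order logic with
  natural numbers, the internal logic of elementary toposes with natural numbers object. HOL is
  classical and has choice, so its own theorems would not express this; the logic is therefore
  an inductively generated derivability relation between terms of a typed object language. No
  rule gives excluded middle or choice.
\<close>

section \<open>Syntax\<close>

datatype ty =
    N
  | Om  \<comment> \<open>truth values\<close>
  | Fun ty ty  (infixr "\<rightarrow>\<^sub>t" 60)
  | Prod ty ty  (infixr "\<times>\<^sub>t" 65)

abbreviation Pow :: "ty \<Rightarrow> ty" where
  "Pow A \<equiv> A \<rightarrow>\<^sub>t Om"

text \<open>
  Terms are locally nameless: bound variables are de Bruijn indices, and a free variable is
  identified by a name together with a type. Formulas are the terms of type \<^term>\<open>Om\<close>.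
\<close>

datatype tm =
    Free string ty
  | Bound nat
  | Lam ty tm
  | App tm tm  (infixl "\<cdot>" 200)
  | Pair tm tm
  | Fst tm
  | Snd tm
  | Zero
  | Succ tm
  | Rec tm tm tm
  | Equal tm tm  (infix "\<approx>" 120)
  | Falsum
  | Conj tm tm  (infixr "\<^bold>\<and>" 115)
  | Disj tm tm  (infixr "\<^bold>\<or>" 110)
  | Impl tm tm  (infixr "\<^bold>\<longrightarrow>" 105)
  | Forall ty tm
  | Exists ty tm

abbreviation Neg :: "tm \<Rightarrow> tm"  ("\<^bold>\<not> _" [118] 118) where
  "\<^bold>\<not> \<phi> \<equiv> \<phi> \<^bold>\<longrightarrow> Falsum"

abbreviation Iff :: "tm \<Rightarrow> tm \<Rightarrow> tm"  (infix "\<^bold>\<longleftrightarrow>" 103) where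
  "\<phi> \<^bold>\<longleftrightarrow> \<psi> \<equiv> (\<phi> \<^bold>\<longrightarrow> \<psi>) \<^bold>\<and> (\<psi> \<^bold>\<longrightarrow> \<phi>)"

text \<open>In \<open>typed E t T\<close> the list \<open>E\<close> gives the types of the loose bound variables of \<open>t\<close>.\<close>

inductive typed :: "ty list \<Rightarrow> tm \<Rightarrow> ty \<Rightarrow> bool" where
  "typed E (Free x T) T"
| "i < length E \<Longrightarrow> typed E (Bound i) (E ! i)"
| "typed (T # E) t U \<Longrightarrow> typed E (Lam T t) (T \<rightarrow>\<^sub>t U)"
| "typed E t (T \<rightarrow>\<^sub>t U) \<Longrightarrow> typed E s T \<Longrightarrow> typed E (t \<cdot> s) U"
| "typed E s T \<Longrightarrow> typed E t U \<Longrightarrow> typed E (Pair s t) (T \<times>\<^sub>t U)"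
| "typed E t (T \<times>\<^sub>t U) \<Longrightarrow> typed E (Fst t) T"
| "typed E t (T \<times>\<^sub>t U) \<Longrightarrow> typed E (Snd t) U"
| "typed E Zero N"
| "typed E t N \<Longrightarrow> typed E (Succ t) N"
| "typed E z T \<Longrightarrow> typed E s (N \<rightarrow>\<^sub>t T \<rightarrow>\<^sub>t T) \<Longrightarrow> typed E n N \<Longrightarrow> typed E (Rec z s n) T"
| "typed E s T \<Longrightarrow> typed E t T \<Longrightarrow> typed E (s \<approx> t) Om"
| "typed E Falsum Om"
| "typed E \<phi> Om \<Longrightarrow> typed E \<psi> Om \<Longrightarrow> typed E (\<phi> \<^bold>\<and> \<psi>) Om"
| "typed E \<phi> Om \<Longrightarrow> typed E \<psi> Om \<Longrightarrow> typed E (\<phi> \<^bold>\<or> \<psi>) Om"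
| "typed E \<phi> Om \<Longrightarrow> typed E \<psi> Om \<Longrightarrow> typed E (\<phi> \<^bold>\<longrightarrow> \<psi>) Om"
| "typed (T # E) \<phi> Om \<Longrightarrow> typed E (Forall T \<phi>) Om"
| "typed (T # E) \<phi> Om \<Longrightarrow> typed E (Exists T \<phi>) Om"

primrec frees :: "tm \<Rightarrow> (string \<times> ty) set" where
  "frees (Free x T) = {(x, T)}"
| "frees (Bound i) = {}"
| "frees (Lam T t) = frees t"
| "frees (t \<cdot> s) = frees t \<union> frees s"
| "frees (Pair s t) = frees s \<union> frees t"
| "frees (Fst t) = frees t"
| "frees (Snd t) = frees t"
| "frees Zero = {}"
| "frees (Succ t) = frees t"
| "frees (Rec z s n) = frees z \<union> frees s \<union> frees n"
| "frees (s \<approx> t) = frees s \<union> frees t"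
| "frees Falsum = {}"
| "frees (\<phi> \<^bold>\<and> \<psi>) = frees \<phi> \<union> frees \<psi>"
| "frees (\<phi> \<^bold>\<or> \<psi>) = frees \<phi> \<union> frees \<psi>"
| "frees (\<phi> \<^bold>\<longrightarrow> \<psi>) = frees \<phi> \<union> frees \<psi>"
| "frees (Forall T \<phi>) = frees \<phi>"
| "frees (Exists T \<phi>) = frees \<phi>"

text \<open>
  \<open>inst k u t\<close> replaces the loose index \<open>k\<close> of \<open>t\<close> by \<open>u\<close>. It is only used for \<open>u\<close> without loose
  indices and \<open>k\<close> the outermost loose index of \<open>t\<close>, so no index has to be shifted.
\<close>

primrec inst :: "nat \<Rightarrow> tm \<Rightarrow> tm \<Rightarrow> tm" where
  "inst k u (Free x T) = Free x T"
| "inst k u (Bound i) = (if i = k then u else Bound i)"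
| "inst k u (Lam T t) = Lam T (inst (Suc k) u t)"
| "inst k u (t \<cdot> s) = inst k u t \<cdot> inst k u s"
| "inst k u (Pair s t) = Pair (inst k u s) (inst k u t)"
| "inst k u (Fst t) = Fst (inst k u t)"
| "inst k u (Snd t) = Snd (inst k u t)"
| "inst k u Zero = Zero"
| "inst k u (Succ t) = Succ (inst k u t)"
| "inst k u (Rec z s n) = Rec (inst k u z) (inst k u s) (inst k u n)"
| "inst k u (s \<approx> t) = (inst k u s \<approx> inst k u t)"
| "inst k u Falsum = Falsum"
| "inst k u (\<phi> \<^bold>\<and> \<psi>) = (inst k u \<phi> \<^bold>\<and> inst k u \<psi>)"
| "inst k u (\<phi> \<^bold>\<or> \<psi>) = (inst k u \<phi> \<^bold>\<or> inst k u \<psi>)"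
| "inst k u (\<phi> \<^bold>\<longrightarrow> \<psi>) = (inst k u \<phi> \<^bold>\<longrightarrow> inst k u \<psi>)"
| "inst k u (Forall T \<phi>) = Forall T (inst (Suc k) u \<phi>)"
| "inst k u (Exists T \<phi>) = Exists T (inst (Suc k) u \<phi>)"

abbreviation subst0 :: "tm \<Rightarrow> tm \<Rightarrow> tm"  ("_\<lbrakk>_\<rbrakk>" [300, 0] 300) where
  "t\<lbrakk>u\<rbrakk> \<equiv> inst 0 u t"

section \<open>Derivability\<close>

text \<open>
  The types of the free variables need not be tracked in a context because every type has a
  closed term. The rule \<open>unique_choice\<close> says that functional relations are graphs of functions;
  it is no form of the axiom of choice, holds in every topos, and in set theory is the
  definition of a function.
\<close>

inductive derives :: "tm list \<Rightarrow> tm \<Rightarrow> bool"  (infix "\<turnstile>" 55) where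
  hyp: "\<phi> \<in> set \<Gamma> \<Longrightarrow> typed [] \<phi> Om \<Longrightarrow> \<Gamma> \<turnstile> \<phi>"
| falsumE: "\<Gamma> \<turnstile> Falsum \<Longrightarrow> typed [] \<phi> Om \<Longrightarrow> \<Gamma> \<turnstile> \<phi>"
| conjI: "\<Gamma> \<turnstile> \<phi> \<Longrightarrow> \<Gamma> \<turnstile> \<psi> \<Longrightarrow> \<Gamma> \<turnstile> \<phi> \<^bold>\<and> \<psi>"
| conjE1: "\<Gamma> \<turnstile> \<phi> \<^bold>\<and> \<psi> \<Longrightarrow> \<Gamma> \<turnstile> \<phi>"
| conjE2: "\<Gamma> \<turnstile> \<phi> \<^bold>\<and> \<psi> \<Longrightarrow> \<Gamma> \<turnstile> \<psi>"
| disjI1: "\<Gamma> \<turnstile> \<phi> \<Longrightarrow> typed [] \<psi> Om \<Longrightarrow> \<Gamma> \<turnstile> \<phi> \<^bold>\<or> \<psi>"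
| disjI2: "\<Gamma> \<turnstile> \<psi> \<Longrightarrow> typed [] \<phi> Om \<Longrightarrow> \<Gamma> \<turnstile> \<phi> \<^bold>\<or> \<psi>"
| disjE: "\<Gamma> \<turnstile> \<phi> \<^bold>\<or> \<psi> \<Longrightarrow> \<phi> # \<Gamma> \<turnstile> \<chi> \<Longrightarrow> \<psi> # \<Gamma> \<turnstile> \<chi> \<Longrightarrow> \<Gamma> \<turnstile> \<chi>"
| implI: "typed [] \<phi> Om \<Longrightarrow> \<phi> # \<Gamma> \<turnstile> \<psi> \<Longrightarrow> \<Gamma> \<turnstile> \<phi> \<^bold>\<longrightarrow> \<psi>"
| implE: "\<Gamma> \<turnstile> \<phi> \<^bold>\<longrightarrow> \<psi> \<Longrightarrow> \<Gamma> \<turnstile> \<phi> \<Longrightarrow> \<Gamma> \<turnstile> \<psi>"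
| forallI: "typed [T] \<phi> Om \<Longrightarrow> (x, T) \<notin> \<Union> (frees ` set (\<phi> # \<Gamma>)) \<Longrightarrow>
    \<Gamma> \<turnstile> \<phi>\<lbrakk>Free x T\<rbrakk> \<Longrightarrow> \<Gamma> \<turnstile> Forall T \<phi>"
| forallE: "\<Gamma> \<turnstile> Forall T \<phi> \<Longrightarrow> typed [] t T \<Longrightarrow> \<Gamma> \<turnstile> \<phi>\<lbrakk>t\<rbrakk>"
| existsI: "typed [T] \<phi> Om \<Longrightarrow> typed [] t T \<Longrightarrow> \<Gamma> \<turnstile> \<phi>\<lbrakk>t\<rbrakk> \<Longrightarrow> \<Gamma> \<turnstile> Exists T \<phi>"
| existsE: "\<Gamma> \<turnstile> Exists T \<phi> \<Longrightarrow> (x, T) \<notin> \<Union> (frees ` set (\<phi> # \<psi> # \<Gamma>)) \<Longrightarrow>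
    \<phi>\<lbrakk>Free x T\<rbrakk> # \<Gamma> \<turnstile> \<psi> \<Longrightarrow> \<Gamma> \<turnstile> \<psi>"
| refl: "typed [] t T \<Longrightarrow> \<Gamma> \<turnstile> t \<approx> t"
| eq_subst: "typed [T] \<phi> Om \<Longrightarrow> typed [] s T \<Longrightarrow> typed [] t T \<Longrightarrow>
    \<Gamma> \<turnstile> s \<approx> t \<Longrightarrow> \<Gamma> \<turnstile> \<phi>\<lbrakk>s\<rbrakk> \<Longrightarrow> \<Gamma> \<turnstile> \<phi>\<lbrakk>t\<rbrakk>"
| beta: "typed [T] t U \<Longrightarrow> typed [] s T \<Longrightarrow> \<Gamma> \<turnstile> Lam T t \<cdot> s \<approx> t\<lbrakk>s\<rbrakk>"
| fun_ext: "typed [] f (T \<rightarrow>\<^sub>t U) \<Longrightarrow> typed [] g (T \<rightarrow>\<^sub>t U) \<Longrightarrow>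
    (x, T) \<notin> \<Union> (frees ` set (f # g # \<Gamma>)) \<Longrightarrow>
    \<Gamma> \<turnstile> f \<cdot> Free x T \<approx> g \<cdot> Free x T \<Longrightarrow> \<Gamma> \<turnstile> f \<approx> g"
| prop_ext: "\<Gamma> \<turnstile> \<phi> \<^bold>\<longleftrightarrow> \<psi> \<Longrightarrow> \<Gamma> \<turnstile> \<phi> \<approx> \<psi>"
| fst_pair: "typed [] s T \<Longrightarrow> typed [] t U \<Longrightarrow> \<Gamma> \<turnstile> Fst (Pair s t) \<approx> s"
| snd_pair: "typed [] s T \<Longrightarrow> typed [] t U \<Longrightarrow> \<Gamma> \<turnstile> Snd (Pair s t) \<approx> t"
| pair_eta: "typed [] t (T \<times>\<^sub>t U) \<Longrightarrow> \<Gamma> \<turnstile> Pair (Fst t) (Snd t) \<approx> t"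
| succ_not_zero: "typed [] n N \<Longrightarrow> \<Gamma> \<turnstile> \<^bold>\<not> (Succ n \<approx> Zero)"
| succ_inj: "\<Gamma> \<turnstile> Succ m \<approx> Succ n \<Longrightarrow> \<Gamma> \<turnstile> m \<approx> n"
| nat_induction: "typed [N] \<phi> Om \<Longrightarrow> typed [] n N \<Longrightarrow> (x, N) \<notin> \<Union> (frees ` set (\<phi> # \<Gamma>)) \<Longrightarrow>
    \<Gamma> \<turnstile> \<phi>\<lbrakk>Zero\<rbrakk> \<Longrightarrow> \<phi>\<lbrakk>Free x N\<rbrakk> # \<Gamma> \<turnstile> \<phi>\<lbrakk>Succ (Free x N)\<rbrakk> \<Longrightarrow> \<Gamma> \<turnstile> \<phi>\<lbrakk>n\<rbrakk>"
| rec_zero: "typed [] z T \<Longrightarrow> typed [] s (N \<rightarrow>\<^sub>t T \<rightarrow>\<^sub>t T) \<Longrightarrow> \<Gamma> \<turnstile> Rec z s Zero \<approx> z"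
| rec_succ: "typed [] z T \<Longrightarrow> typed [] s (N \<rightarrow>\<^sub>t T \<rightarrow>\<^sub>t T) \<Longrightarrow> typed [] n N \<Longrightarrow>
    \<Gamma> \<turnstile> Rec z s (Succ n) \<approx> s \<cdot> n \<cdot> Rec z s n"
| unique_choice: "typed [] R (T \<rightarrow>\<^sub>t U \<rightarrow>\<^sub>t Om) \<Longrightarrow>
    \<Gamma> \<turnstile> Forall T (Exists U (R \<cdot> Bound 1 \<cdot> Bound 0 \<^bold>\<and>
          Forall U (R \<cdot> Bound 2 \<cdot> Bound 0 \<^bold>\<longrightarrow> Bound 0 \<approx> Bound 1))) \<Longrightarrow>
    \<Gamma> \<turnstile> Exists (T \<rightarrow>\<^sub>t U) (Forall T (R \<cdot> Bound 0 \<cdot> (Bound 1 \<cdot> Bound 0)))"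

text \<open>Only formulas are derivable.\<close>

lemma typed_append: "typed E t T \<Longrightarrow> typed (E @ E') t T"
proof (induction rule: typed.induct)
  case (2 i E)
  then have "typed (E @ E') (Bound i) ((E @ E') ! i)"
    by (intro typed.intros) simp
  with 2 show ?case by (simp add: nth_append)
qed (auto intro: typed.intros)

lemma typed_inst:
  assumes "typed E' t U" and "E' = E @ [T]" and "typed [] u T"
  shows "typed E (inst (length E) u t) U"
  using assms
proof (induction arbitrary: E rule: typed.induct)
  case (2 i E')
  show ?case
  proof (cases "i = length E")
    case True
    with 2 show ?thesis using typed_append[of "[]" u T E] by simp
  next
    case False
    with 2 have "i < length E" by simp
    with 2 show ?thesis using typed.intros(2)[of i E] by (simp add: nth_append)
  qed
next
  case (3 T' E' t U)
  from "3.IH"[of "T' # E"] 3 show ?case by (auto intro: typed.intros)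
next
  case (16 T' E' \<phi>)
  from "16.IH"[of "T' # E"] 16 show ?case by (auto intro: typed.intros)
next
  case (17 T' E' \<phi>)
  from "17.IH"[of "T' # E"] 17 show ?case by (auto intro: typed.intros)
qed (auto intro: typed.intros)

lemma typed_subst0: "typed [T] t U \<Longrightarrow> typed [] u T \<Longrightarrow> typed [] (t\<lbrakk>u\<rbrakk>) U"
  using typed_inst[of "[T]" t U "[]" T u] by simp

inductive_cases typed_BoundE: "typed E (Bound i) U"
inductive_cases typed_LamE: "typed E (Lam T t) U"
inductive_cases typed_AppE: "typed E (t \<cdot> s) U"
inductive_cases typed_SuccE: "typed E (Succ t) U"
inductive_cases typed_EqualE: "typed E (s \<approx> t) U"
inductive_cases typed_ConjE: "typed E (\<phi> \<^bold>\<and> \<psi>) U"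
inductive_cases typed_DisjE: "typed E (\<phi> \<^bold>\<or> \<psi>) U"
inductive_cases typed_ImplE: "typed E (\<phi> \<^bold>\<longrightarrow> \<psi>) U"
inductive_cases typed_ForallE: "typed E (Forall T \<phi>) U"
inductive_cases typed_ExistsE: "typed E (Exists T \<phi>) U"

lemma typed_Bound: "i < length E \<Longrightarrow> E ! i = T \<Longrightarrow> typed E (Bound i) T"
  by (auto intro: typed.intros)

lemmas typed_rules = typed.intros(1) typed_Bound typed.intros(3-)
lemmas nth_rules = nth_Cons_0 nth_Cons_Suc One_nat_def numeral_2_eq_2

lemma derives_typed: "\<Gamma> \<turnstile> \<phi> \<Longrightarrow> typed [] \<phi> Om"
proof (induction rule: derives.induct)
  case (unique_choice R T U \<Gamma>)
  have R: "typed E R (T \<rightarrow>\<^sub>t U \<rightarrow>\<^sub>t Om)" for E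
    using typed_append[OF unique_choice.hyps(1), of E] by simp
  show ?case
    by (rule R typed_rules | simp only: nth_rules | simp; fail)+
qed (auto intro: typed.intros typed_subst0
       elim: typed_ConjE typed_DisjE typed_ImplE typed_ForallE typed_ExistsE typed_EqualE typed_SuccE)

section \<open>Named binders\<close>

text \<open>
  To write object-level formulas with named variables, \<open>close k x T t\<close> turns the free variable
  \<open>x\<close> of type \<open>T\<close> into the bound variable that is loose at index \<open>k\<close>. Nested binders must use
  different names.
\<close>

primrec close :: "nat \<Rightarrow> string \<Rightarrow> ty \<Rightarrow> tm \<Rightarrow> tm" where
  "close k x T (Free y U) = (if y = x \<and> U = T then Bound k else Free y U)"
| "close k x T (Bound i) = Bound i"
| "close k x T (Lam U t) = Lam U (close (Suc k) x T t)"
| "close k x T (t \<cdot> s) = close k x T t \<cdot> close k x T s"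
| "close k x T (Pair s t) = Pair (close k x T s) (close k x T t)"
| "close k x T (Fst t) = Fst (close k x T t)"
| "close k x T (Snd t) = Snd (close k x T t)"
| "close k x T Zero = Zero"
| "close k x T (Succ t) = Succ (close k x T t)"
| "close k x T (Rec z s n) = Rec (close k x T z) (close k x T s) (close k x T n)"
| "close k x T (s \<approx> t) = (close k x T s \<approx> close k x T t)"
| "close k x T Falsum = Falsum"
| "close k x T (\<phi> \<^bold>\<and> \<psi>) = (close k x T \<phi> \<^bold>\<and> close k x T \<psi>)"
| "close k x T (\<phi> \<^bold>\<or> \<psi>) = (close k x T \<phi> \<^bold>\<or> close k x T \<psi>)"
| "close k x T (\<phi> \<^bold>\<longrightarrow> \<psi>) = (close k x T \<phi> \<^bold>\<longrightarrow> close k x T \<psi>)"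
| "close k x T (Forall U \<phi>) = Forall U (close (Suc k) x T \<phi>)"
| "close k x T (Exists U \<phi>) = Exists U (close (Suc k) x T \<phi>)"

definition fn :: "string \<Rightarrow> ty \<Rightarrow> (tm \<Rightarrow> tm) \<Rightarrow> tm" where
  "fn x T F = Lam T (close 0 x T (F (Free x T)))"

definition all :: "string \<Rightarrow> ty \<Rightarrow> (tm \<Rightarrow> tm) \<Rightarrow> tm" where
  "all x T F = Forall T (close 0 x T (F (Free x T)))"

definition ex :: "string \<Rightarrow> ty \<Rightarrow> (tm \<Rightarrow> tm) \<Rightarrow> tm" where
  "ex x T F = Exists T (close 0 x T (F (Free x T)))"

section \<open>Rational numbers and MacNeille reals\<close>

definition add :: tm where
  "add = fn ''m'' N (\<lambda>m. fn ''n'' N (\<lambda>n.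
     Rec m (fn ''k'' N (\<lambda>k. fn ''r'' N (\<lambda>r. Succ r))) n))"

definition mul :: tm where
  "mul = fn ''m'' N (\<lambda>m. fn ''n'' N (\<lambda>n.
     Rec Zero (fn ''k'' N (\<lambda>k. fn ''r'' N (\<lambda>r. add \<cdot> r \<cdot> m))) n))"

definition less_nat :: tm where
  "less_nat = fn ''m'' N (\<lambda>m. fn ''n'' N (\<lambda>n. ex ''k'' N (\<lambda>k. n \<approx> add \<cdot> m \<cdot> Succ k)))"

text \<open>
  A triple \<open>(a, (b, c))\<close> represents the rational number \<open>(a - b) / (c + 1)\<close>. Every rational number
  has many representatives, so subsets of the rationals correspond to those sets of triples that
  do not distinguish representatives of the same number. The sets making up a MacNeille real
  are of this kind by their definition, because they are characterized by \<open>less_rat\<close> alone; hence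
  equality of MacNeille reals is equality of pairs of sets of triples.
\<close>

abbreviation Q :: ty where
  "Q \<equiv> N \<times>\<^sub>t N \<times>\<^sub>t N"

definition less_rat :: tm where
  "less_rat = fn ''p'' Q (\<lambda>p. fn ''q'' Q (\<lambda>q.
     let a = Fst p; b = Fst (Snd p); d = Succ (Snd (Snd p));
         a' = Fst q; b' = Fst (Snd q); d' = Succ (Snd (Snd q))
     in less_nat \<cdot> (add \<cdot> (mul \<cdot> a \<cdot> d') \<cdot> (mul \<cdot> b' \<cdot> d))
                 \<cdot> (add \<cdot> (mul \<cdot> a' \<cdot> d) \<cdot> (mul \<cdot> b \<cdot> d'))))"

abbreviation Cut :: ty where
  "Cut \<equiv> Pow Q \<times>\<^sub>t Pow Q"

definition macneille_real :: tm where
  "macneille_real = fn ''x'' Cut (\<lambda>x. let L = Fst x; U = Snd x in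
     ex ''p'' Q (\<lambda>p. L \<cdot> p) \<^bold>\<and>
     ex ''q'' Q (\<lambda>q. U \<cdot> q) \<^bold>\<and>
     all ''p'' Q (\<lambda>p. L \<cdot> p \<^bold>\<longleftrightarrow> ex ''q'' Q (\<lambda>q. less_rat \<cdot> p \<cdot> q \<^bold>\<and> \<^bold>\<not> (U \<cdot> q))) \<^bold>\<and>
     all ''q'' Q (\<lambda>q. U \<cdot> q \<^bold>\<longleftrightarrow> ex ''p'' Q (\<lambda>p. less_rat \<cdot> p \<cdot> q \<^bold>\<and> \<^bold>\<not> (L \<cdot> p))))"

lemmas binder_defs = fn_def all_def ex_def

lemma typed_add: "typed E add (N \<rightarrow>\<^sub>t N \<rightarrow>\<^sub>t N)"
  unfolding add_def binder_defs
  by simp (rule typed_rules | simp only: nth_rules | simp; fail)+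

lemma close_add [simp]: "close k x T add = add"
  by (simp add: add_def binder_defs)

lemma typed_mul: "typed E mul (N \<rightarrow>\<^sub>t N \<rightarrow>\<^sub>t N)"
  unfolding mul_def binder_defs
  by simp (rule typed_rules typed_add | simp only: nth_rules | simp; fail)+

lemma close_mul [simp]: "close k x T mul = mul"
  by (simp add: mul_def binder_defs)

lemma typed_less_nat: "typed E less_nat (N \<rightarrow>\<^sub>t N \<rightarrow>\<^sub>t Om)"
  unfolding less_nat_def binder_defs
  by simp (rule typed_rules typed_add | simp only: nth_rules | simp; fail)+

lemma close_less_nat [simp]: "close k x T less_nat = less_nat"
  by (simp add: less_nat_def binder_defs)

lemma typed_less_rat: "typed E less_rat (Q \<rightarrow>\<^sub>t Q \<rightarrow>\<^sub>t Om)"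
  unfolding less_rat_def binder_defs Let_def
  by simp (rule typed_rules typed_add typed_mul typed_less_nat | simp only: nth_rules | simp; fail)+

lemma close_less_rat [simp]: "close k x T less_rat = less_rat"
  by (simp add: less_rat_def binder_defs Let_def)

lemma typed_macneille_real: "typed E macneille_real (Pow Cut)"
  unfolding macneille_real_def binder_defs Let_def
  by simp (rule typed_rules typed_less_rat | simp only: nth_rules | simp; fail)+

lemma close_macneille_real [simp]: "close k x T macneille_real = macneille_real"
  by (simp add: macneille_real_def binder_defs Let_def)

end

theory Submission
  imports Defs
begin

text \<open>
  The number \<open>x0\<close> comes from nested intervals of length \<open>3 ^ -n\<close>, starting from the one between 1 and
  2. Of the interval of stage \<open>n\<close> the left third is kept if its right endpoint \<open>c\<close> belongs to the lower
  set of \<open>f n\<close>, and the right third otherwise. Let \<open>x0\<close> be the supremum of all left endpoints, and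
  suppose that \<open>f n = x0\<close>. If the left third was kept, then \<open>c\<close> bounds all left endpoints from above, so
  \<open>c\<close> is not in the lower set of \<open>x0\<close>, although it is in that of \<open>f n\<close>. If the right third was kept,
  then \<open>c\<close> lies strictly below a left endpoint, so it is in the lower set of \<open>x0\<close>, although it is not
  in that of \<open>f n\<close>. This is \<open>supremum_not_in_range\<close>.

  Constructively one cannot decide which third to keep, so the interval of stage \<open>n\<close> is not a function of
  \<open>n\<close>. It is represented by a set \<open>cell f n\<close>, defined by recursion into a power type, with at most one
  element (\<open>cell_unique\<close>) and not empty, in the sense of a double negation (\<open>cell_exists\<close>). That
  is enough, because what has to be known about the intervals is negative: a right endpoint is never less
  than a left endpoint (\<open>hi_not_less_lo\<close>), and \<open>f n = x0\<close> is absurd. The supremum itself nevertheless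
  exists outright (\<open>macneille_supremum\<close>): membership in either half of a MacNeille cut asks for a rational
  witness together with a negated statement only, and the witnesses needed to see that both halves are
  inhabited are found next to the initial interval, which is given explicitly.

  The derivation is assembled in the metalogic. Weakening turns the rules with eigenvariables into
  rules that quantify over all larger contexts and all closed terms, such as \<open>forall_intro\<close>,
  \<open>impl_intro\<close> and \<open>exists_elim\<close>; so derivability is handled like forcing at a stage, where the stages
  are the contexts. Derivable identities between numerical terms come from polynomial normalization in a
  quotient of the type of terms (\<open>cls_eq\<close>).
\<close>

section \<open>Weakening\<close>

text \<open>
  Weakening is not a rule of the calculus, because the eigenvariable of a rule may occur in the larger
  context. The induction for it has to rename eigenvariables, so it is carried out for derivations
  under an arbitrary renaming of the free variables.
\<close>

primrec ren :: "(string \<times> ty \<Rightarrow> string) \<Rightarrow> tm \<Rightarrow> tm" where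
  "ren \<rho> (Free x T) = Free (\<rho> (x, T)) T"
| "ren \<rho> (Bound i) = Bound i"
| "ren \<rho> (Lam T t) = Lam T (ren \<rho> t)"
| "ren \<rho> (t \<cdot> s) = ren \<rho> t \<cdot> ren \<rho> s"
| "ren \<rho> (Pair s t) = Pair (ren \<rho> s) (ren \<rho> t)"
| "ren \<rho> (Fst t) = Fst (ren \<rho> t)"
| "ren \<rho> (Snd t) = Snd (ren \<rho> t)"
| "ren \<rho> Zero = Zero"
| "ren \<rho> (Succ t) = Succ (ren \<rho> t)"
| "ren \<rho> (Rec z s n) = Rec (ren \<rho> z) (ren \<rho> s) (ren \<rho> n)"
| "ren \<rho> (s \<approx> t) = (ren \<rho> s \<approx> ren \<rho> t)"
| "ren \<rho> Falsum = Falsum"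
| "ren \<rho> (\<phi> \<^bold>\<and> \<psi>) = (ren \<rho> \<phi> \<^bold>\<and> ren \<rho> \<psi>)"
| "ren \<rho> (\<phi> \<^bold>\<or> \<psi>) = (ren \<rho> \<phi> \<^bold>\<or> ren \<rho> \<psi>)"
| "ren \<rho> (\<phi> \<^bold>\<longrightarrow> \<psi>) = (ren \<rho> \<phi> \<^bold>\<longrightarrow> ren \<rho> \<psi>)"
| "ren \<rho> (Forall T \<phi>) = Forall T (ren \<rho> \<phi>)"
| "ren \<rho> (Exists T \<phi>) = Exists T (ren \<rho> \<phi>)"

lemma ren_inst: "ren \<rho> (inst k u t) = inst k (ren \<rho> u) (ren \<rho> t)"
  by (induction t arbitrary: k) auto

lemma typed_ren: "typed E t T \<Longrightarrow> typed E (ren \<rho> t) T"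
  by (induction rule: typed.induct) (auto intro: typed.intros)

lemma ren_fresh: "(x, T) \<notin> frees t \<Longrightarrow> ren (\<rho>((x, T) := y)) t = ren \<rho> t"
  by (induction t) auto

lemma ren_id: "ren fst t = t"
  by (induction t) auto

lemma finite_frees: "finite (frees t)"
  by (induction t) auto

lemma fresh_name:
  obtains x :: string where "(x, T) \<notin> \<Union> (frees ` set ts)"
proof -
  have "finite ((\<lambda>x. (x, T)) -` \<Union> (frees ` set ts))"
    by (intro finite_vimageI) (auto simp: finite_frees inj_on_def)
  then obtain x :: string where "x \<notin> (\<lambda>x. (x, T)) -` \<Union> (frees ` set ts)"
    using ex_new_if_finite[OF infinite_UNIV_listI] by blast
  then show thesis
    using that by simp
qed

lemma rename_fresh:
  obtains \<rho>' where "(\<rho>' (x, T), T) \<notin> \<Union> (frees ` set ts)"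
    "\<And>t. (x, T) \<notin> frees t \<Longrightarrow> ren \<rho>' t = ren \<rho> t"
proof -
  obtain y where "(y, T) \<notin> \<Union> (frees ` set ts)"
    using fresh_name by blast
  then show thesis
    using that[of "\<rho>((x, T) := y)"] ren_fresh[of x T _ \<rho> y] by simp
qed

lemma derives_ren:
  "\<Gamma> \<turnstile> \<phi> \<Longrightarrow> ren \<rho> ` set \<Gamma> \<subseteq> set \<Delta> \<Longrightarrow> \<Delta> \<turnstile> ren \<rho> \<phi>"
proof (induction arbitrary: \<rho> \<Delta> rule: derives.induct)
  case (hyp \<phi> \<Gamma>)
  then show ?case by (auto intro: derives.hyp typed_ren)
next
  case (disjE \<Gamma> \<phi> \<psi> \<chi>)
  show ?case
  proof (rule derives.disjE)
    show "\<Delta> \<turnstile> ren \<rho> \<phi> \<^bold>\<or> ren \<rho> \<psi>"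
      using disjE.IH(1) disjE.prems by simp
    show "ren \<rho> \<phi> # \<Delta> \<turnstile> ren \<rho> \<chi>"
      using disjE.prems by (intro disjE.IH(2)) auto
    show "ren \<rho> \<psi> # \<Delta> \<turnstile> ren \<rho> \<chi>"
      using disjE.prems by (intro disjE.IH(3)) auto
  qed
next
  case (implI \<phi> \<Gamma> \<psi>)
  have "ren \<rho> \<phi> # \<Delta> \<turnstile> ren \<rho> \<psi>"
    using implI.prems by (intro implI.IH) auto
  then show ?case
    using implI.hyps by (auto intro: derives.implI typed_ren)
next
  case (implE \<Gamma> \<phi> \<psi>)
  then show ?case by (intro derives.implE[of \<Delta> "ren \<rho> \<phi>" "ren \<rho> \<psi>"]) auto
next
  case (forallI T \<phi> x \<Gamma>)
  obtain \<rho>' where y: "(\<rho>' (x, T), T) \<notin> \<Union> (frees ` set (ren \<rho> \<phi> # \<Delta>))"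
    and \<rho>': "\<And>t. (x, T) \<notin> frees t \<Longrightarrow> ren \<rho>' t = ren \<rho> t"
    using rename_fresh[where ts = "ren \<rho> \<phi> # \<Delta>" and x = x and T = T and \<rho> = \<rho>] by blast
  have "\<Delta> \<turnstile> ren \<rho>' (\<phi>\<lbrakk>Free x T\<rbrakk>)"
    using forallI.prems forallI.hyps \<rho>' by (intro forallI.IH) auto
  then have "\<Delta> \<turnstile> (ren \<rho> \<phi>)\<lbrakk>Free (\<rho>' (x, T)) T\<rbrakk>"
    using forallI.hyps by (simp add: ren_inst \<rho>')
  from derives.forallI[OF typed_ren[OF forallI.hyps(1)] y this] show ?case
    by simp
next
  case (forallE \<Gamma> T \<phi> t)
  then have "\<Delta> \<turnstile> (ren \<rho> \<phi>)\<lbrakk>ren \<rho> t\<rbrakk>"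
    by (intro derives.forallE) (auto intro: typed_ren)
  then show ?case by (simp add: ren_inst)
next
  case (existsI T \<phi> t \<Gamma>)
  then have "\<Delta> \<turnstile> (ren \<rho> \<phi>)\<lbrakk>ren \<rho> t\<rbrakk>"
    by (simp flip: ren_inst)
  then show ?case
    using existsI.hyps by (auto intro: derives.existsI typed_ren)
next
  case (existsE \<Gamma> T \<phi> x \<psi>)
  obtain \<rho>' where y: "(\<rho>' (x, T), T) \<notin> \<Union> (frees ` set (ren \<rho> \<phi> # ren \<rho> \<psi> # \<Delta>))"
    and \<rho>': "\<And>t. (x, T) \<notin> frees t \<Longrightarrow> ren \<rho>' t = ren \<rho> t"
    using rename_fresh[where ts = "ren \<rho> \<phi> # ren \<rho> \<psi> # \<Delta>" and x = x and T = T and \<rho> = \<rho>] by blast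
  have "ren \<rho>' (\<phi>\<lbrakk>Free x T\<rbrakk>) # \<Delta> \<turnstile> ren \<rho>' \<psi>"
    using existsE.prems existsE.hyps \<rho>' by (intro existsE.IH(2)) auto
  then have "(ren \<rho> \<phi>)\<lbrakk>Free (\<rho>' (x, T)) T\<rbrakk> # \<Delta> \<turnstile> ren \<rho> \<psi>"
    using existsE.hyps by (simp add: ren_inst \<rho>')
  moreover have "\<Delta> \<turnstile> Exists T (ren \<rho> \<phi>)"
    using existsE by auto
  ultimately show ?case
    using derives.existsE[OF _ y] by blast
next
  case (eq_subst T \<phi> s t \<Gamma>)
  have "\<Delta> \<turnstile> ren \<rho> s \<approx> ren \<rho> t" "\<Delta> \<turnstile> (ren \<rho> \<phi>)\<lbrakk>ren \<rho> s\<rbrakk>"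
    using eq_subst.IH[OF eq_subst.prems] by (simp_all add: ren_inst)
  then have "\<Delta> \<turnstile> (ren \<rho> \<phi>)\<lbrakk>ren \<rho> t\<rbrakk>"
    using derives.eq_subst[OF eq_subst.hyps(1-3)[THEN typed_ren]] by blast
  then show ?case by (simp add: ren_inst)
next
  case (beta T t U s \<Gamma>)
  then show ?case
    by (auto simp: ren_inst intro!: derives.beta typed_ren)
next
  case (fun_ext f T U g x \<Gamma>)
  obtain \<rho>' where y: "(\<rho>' (x, T), T) \<notin> \<Union> (frees ` set (ren \<rho> f # ren \<rho> g # \<Delta>))"
    and \<rho>': "\<And>t. (x, T) \<notin> frees t \<Longrightarrow> ren \<rho>' t = ren \<rho> t"
    using rename_fresh[where ts = "ren \<rho> f # ren \<rho> g # \<Delta>" and x = x and T = T and \<rho> = \<rho>] by blast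
  have "\<Delta> \<turnstile> ren \<rho>' (f \<cdot> Free x T \<approx> g \<cdot> Free x T)"
    using fun_ext.prems fun_ext.hyps \<rho>' by (intro fun_ext.IH) auto
  then have "\<Delta> \<turnstile> ren \<rho> f \<cdot> Free (\<rho>' (x, T)) T \<approx> ren \<rho> g \<cdot> Free (\<rho>' (x, T)) T"
    using fun_ext.hyps by (simp add: \<rho>')
  from derives.fun_ext[OF typed_ren[OF fun_ext.hyps(1)] typed_ren[OF fun_ext.hyps(2)] y this]
  show ?case
    by simp
next
  case (nat_induction \<phi> n x \<Gamma>)
  obtain \<rho>' where y: "(\<rho>' (x, N), N) \<notin> \<Union> (frees ` set (ren \<rho> \<phi> # \<Delta>))"
    and \<rho>': "\<And>t. (x, N) \<notin> frees t \<Longrightarrow> ren \<rho>' t = ren \<rho> t"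
    using rename_fresh[where ts = "ren \<rho> \<phi> # \<Delta>" and x = x and T = N and \<rho> = \<rho>] by blast
  have "ren \<rho>' (\<phi>\<lbrakk>Free x N\<rbrakk>) # \<Delta> \<turnstile> ren \<rho>' (\<phi>\<lbrakk>Succ (Free x N)\<rbrakk>)"
    using nat_induction.prems nat_induction.hyps \<rho>' by (intro nat_induction.IH(2)) auto
  then have "(ren \<rho> \<phi>)\<lbrakk>Free (\<rho>' (x, N)) N\<rbrakk> # \<Delta> \<turnstile> (ren \<rho> \<phi>)\<lbrakk>Succ (Free (\<rho>' (x, N)) N)\<rbrakk>"
    using nat_induction.hyps by (simp add: ren_inst \<rho>')
  moreover have "\<Delta> \<turnstile> (ren \<rho> \<phi>)\<lbrakk>Zero\<rbrakk>"
    using nat_induction.IH(1)[OF nat_induction.prems] by (simp add: ren_inst)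
  ultimately have "\<Delta> \<turnstile> (ren \<rho> \<phi>)\<lbrakk>ren \<rho> n\<rbrakk>"
    using derives.nat_induction[OF nat_induction.hyps(1,2)[THEN typed_ren] y] by blast
  then show ?case by (simp add: ren_inst)
next
  case (unique_choice R T U \<Gamma>)
  show ?case
    using derives.unique_choice[OF typed_ren[OF unique_choice.hyps(1)]]
      unique_choice.IH[OF unique_choice.prems] by (simp only: ren.simps)
next
  case (conjE1 \<Gamma> \<phi> \<psi>)
  then show ?case using derives.conjE1 by fastforce
next
  case (conjE2 \<Gamma> \<phi> \<psi>)
  then show ?case using derives.conjE2 by fastforce
next
  case (falsumE \<Gamma> \<phi>)
  then show ?case using derives.falsumE typed_ren by fastforce
qed (auto intro: typed_ren derives.conjI derives.disjI1 derives.disjI2 derives.refl derives.prop_ext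
  derives.fst_pair derives.snd_pair derives.pair_eta derives.succ_not_zero derives.succ_inj
  derives.rec_zero derives.rec_succ)

text \<open>
  Contexts are compared as sets. They play the part of the stages of a Kripke model: derivability
  persists along this order by weakening, and \<open>impl_intro\<close> characterizes an implication by what holds
  in all larger contexts.
\<close>

definition weaker :: "tm list \<Rightarrow> tm list \<Rightarrow> bool"  (infix "\<sqsubseteq>" 50) where
  "\<Gamma> \<sqsubseteq> \<Delta> \<longleftrightarrow> set \<Gamma> \<subseteq> set \<Delta>"

lemma weakening: "\<Gamma> \<turnstile> \<phi> \<Longrightarrow> \<Gamma> \<sqsubseteq> \<Delta> \<Longrightarrow> \<Delta> \<turnstile> \<phi>"
  using derives_ren[of \<Gamma> \<phi> fst \<Delta>] by (simp add: ren_id weaker_def)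

section \<open>Type checking by simplification\<close>

text \<open>
  A computable form of the typing relation, so that the simplifier settles typing conditions. For a
  closed term of known type the facts provided by \<open>closedD\<close> make it opaque for both type
  checking and instantiation of bound variables.
\<close>

fun type_of :: "ty list \<Rightarrow> tm \<Rightarrow> ty option" where
  "type_of E (Free x T) = Some T"
| "type_of E (Bound i) = (if i < length E then Some (E ! i) else None)"
| "type_of E (Lam T t) = map_option (\<lambda>U. T \<rightarrow>\<^sub>t U) (type_of (T # E) t)"
| "type_of E (t \<cdot> s) = (case type_of E t of Some (T \<rightarrow>\<^sub>t U) \<Rightarrow> if type_of E s = Some T then Some U else None | _ \<Rightarrow> None)"
| "type_of E (Pair s t) = (case (type_of E s, type_of E t) of (Some T, Some U) \<Rightarrow> Some (T \<times>\<^sub>t U) | _ \<Rightarrow> None)"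
| "type_of E (Fst t) = (case type_of E t of Some (T \<times>\<^sub>t U) \<Rightarrow> Some T | _ \<Rightarrow> None)"
| "type_of E (Snd t) = (case type_of E t of Some (T \<times>\<^sub>t U) \<Rightarrow> Some U | _ \<Rightarrow> None)"
| "type_of E Zero = Some N"
| "type_of E (Succ t) = (if type_of E t = Some N then Some N else None)"
| "type_of E (Rec z s n) = (case type_of E z of Some T \<Rightarrow>
     if type_of E s = Some (N \<rightarrow>\<^sub>t T \<rightarrow>\<^sub>t T) \<and> type_of E n = Some N then Some T else None | _ \<Rightarrow> None)"
| "type_of E (s \<approx> t) = (case type_of E s of Some T \<Rightarrow> if type_of E t = Some T then Some Om else None | _ \<Rightarrow> None)"
| "type_of E Falsum = Some Om"
| "type_of E (\<phi> \<^bold>\<and> \<psi>) = (if type_of E \<phi> = Some Om \<and> type_of E \<psi> = Some Om then Some Om else None)"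
| "type_of E (\<phi> \<^bold>\<or> \<psi>) = (if type_of E \<phi> = Some Om \<and> type_of E \<psi> = Some Om then Some Om else None)"
| "type_of E (\<phi> \<^bold>\<longrightarrow> \<psi>) = (if type_of E \<phi> = Some Om \<and> type_of E \<psi> = Some Om then Some Om else None)"
| "type_of E (Forall T \<phi>) = (if type_of (T # E) \<phi> = Some Om then Some Om else None)"
| "type_of E (Exists T \<phi>) = (if type_of (T # E) \<phi> = Some Om then Some Om else None)"

lemma typed_type_of: "typed E t T \<Longrightarrow> type_of E t = Some T"
  by (induction rule: typed.induct) auto

lemma type_of_typed: "type_of E t = Some T \<Longrightarrow> typed E t T"
  by (induction t arbitrary: E T)
    (auto intro: typed.intros split: option.splits ty.splits if_splits,
      (blast intro: typed.intros)+)

lemma typed_iff: "typed E t T \<longleftrightarrow> type_of E t = Some T"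
  using typed_type_of type_of_typed by blast

lemma inst_typed: "typed E t T \<Longrightarrow> length E \<le> k \<Longrightarrow> inst k u t = t"
  by (induction arbitrary: k rule: typed.induct) auto

lemma inst_closed: "typed [] t T \<Longrightarrow> inst k u t = t"
  by (rule inst_typed) auto

lemma typed_closed: "typed [] t T \<Longrightarrow> typed E t T"
  using typed_append[of "[]"] by simp

lemma closedD:
  assumes "typed [] t T"
  shows "(\<forall>E. type_of E t = Some T) \<and> (\<forall>k u. inst k u t = t)"
  using typed_closed[OF assms] inst_closed[OF assms] by (simp add: typed_iff)

lemmas closed_consts [simp] =
  typed_add[THEN closedD] typed_mul[THEN closedD] typed_less_nat[THEN closedD]
  typed_less_rat[THEN closedD] typed_macneille_real[THEN closedD]

section \<open>Rules without eigenvariables\<close>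

lemma weaker_refl: "\<Gamma> \<sqsubseteq> \<Gamma>" and weaker_trans: "\<Gamma> \<sqsubseteq> \<Delta> \<Longrightarrow> \<Delta> \<sqsubseteq> \<Theta> \<Longrightarrow> \<Gamma> \<sqsubseteq> \<Theta>"
  and weaker_Cons: "\<Gamma> \<sqsubseteq> \<phi> # \<Gamma>"
  by (auto simp: weaker_def)

text \<open>
  Closed terms may contain free variables, so quantifying over all closed terms in the metalogic
  includes the fresh variable which the object rule asks for. In this form the rules mention neither
  names nor freshness.
\<close>

lemma forall_intro:
  assumes "typed [T] \<phi> Om" and "\<And>t. typed [] t T \<Longrightarrow> \<Gamma> \<turnstile> \<phi>\<lbrakk>t\<rbrakk>"
  shows "\<Gamma> \<turnstile> Forall T \<phi>"
proof -
  obtain x where x: "(x, T) \<notin> \<Union> (frees ` set (\<phi> # \<Gamma>))"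
    by (rule fresh_name)
  show ?thesis
    by (rule forallI[OF assms(1) x assms(2)]) (rule typed.intros)
qed

lemma impl_intro:
  assumes "typed [] \<phi> Om" and "\<And>\<Delta>. \<Gamma> \<sqsubseteq> \<Delta> \<Longrightarrow> \<Delta> \<turnstile> \<phi> \<Longrightarrow> \<Delta> \<turnstile> \<psi>"
  shows "\<Gamma> \<turnstile> \<phi> \<^bold>\<longrightarrow> \<psi>"
  by (intro implI assms weaker_Cons hyp) simp_all

lemma exists_elim:
  assumes ex: "\<Gamma> \<turnstile> Exists T \<phi>"
    and "\<And>\<Delta> t. \<Gamma> \<sqsubseteq> \<Delta> \<Longrightarrow> typed [] t T \<Longrightarrow> \<Delta> \<turnstile> \<phi>\<lbrakk>t\<rbrakk> \<Longrightarrow> \<Delta> \<turnstile> \<psi>"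
  shows "\<Gamma> \<turnstile> \<psi>"
proof -
  obtain x where x: "(x, T) \<notin> \<Union> (frees ` set (\<phi> # \<psi> # \<Gamma>))"
    by (rule fresh_name)
  have "typed [T] \<phi> Om"
    using derives_typed[OF ex] by (auto elim: typed_ExistsE)
  then have "typed [] (\<phi>\<lbrakk>Free x T\<rbrakk>) Om"
    by (intro typed_subst0) (auto intro: typed.intros)
  then show ?thesis
    by (intro existsE[OF ex x] assms(2) weaker_Cons hyp) (simp_all add: typed_iff)
qed

lemma disj_elim:
  assumes disj: "\<Gamma> \<turnstile> \<phi> \<^bold>\<or> \<psi>"
    and "\<And>\<Delta>. \<Gamma> \<sqsubseteq> \<Delta> \<Longrightarrow> \<Delta> \<turnstile> \<phi> \<Longrightarrow> \<Delta> \<turnstile> \<chi>"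
    and "\<And>\<Delta>. \<Gamma> \<sqsubseteq> \<Delta> \<Longrightarrow> \<Delta> \<turnstile> \<psi> \<Longrightarrow> \<Delta> \<turnstile> \<chi>"
  shows "\<Gamma> \<turnstile> \<chi>"
proof -
  have "typed [] \<phi> Om" "typed [] \<psi> Om"
    using derives_typed[OF disj] by (auto elim: typed_DisjE)
  then show ?thesis
    by (intro disjE[OF disj] assms(2,3) weaker_Cons hyp) simp_all
qed

lemma induct_nat:
  assumes \<phi>: "typed [N] \<phi> Om" and n: "typed [] n N" and zero: "\<Gamma> \<turnstile> \<phi>\<lbrakk>Zero\<rbrakk>"
    and suc: "\<And>\<Delta> m. \<Gamma> \<sqsubseteq> \<Delta> \<Longrightarrow> typed [] m N \<Longrightarrow> \<Delta> \<turnstile> \<phi>\<lbrakk>m\<rbrakk> \<Longrightarrow> \<Delta> \<turnstile> \<phi>\<lbrakk>Succ m\<rbrakk>"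
  shows "\<Gamma> \<turnstile> \<phi>\<lbrakk>n\<rbrakk>"
proof -
  obtain x where x: "(x, N) \<notin> \<Union> (frees ` set (\<phi> # \<Gamma>))"
    by (rule fresh_name)
  have "typed [] (\<phi>\<lbrakk>Free x N\<rbrakk>) Om"
    by (intro typed_subst0[OF \<phi>] typed.intros)
  then show ?thesis
    by (intro nat_induction[OF \<phi> n x zero] suc weaker_Cons hyp) (simp_all add: typed_iff)
qed

lemma iff_intro:
  assumes "typed [] \<phi> Om" and "typed [] \<psi> Om"
    and "\<And>\<Delta>. \<Gamma> \<sqsubseteq> \<Delta> \<Longrightarrow> \<Delta> \<turnstile> \<phi> \<Longrightarrow> \<Delta> \<turnstile> \<psi>" and "\<And>\<Delta>. \<Gamma> \<sqsubseteq> \<Delta> \<Longrightarrow> \<Delta> \<turnstile> \<psi> \<Longrightarrow> \<Delta> \<turnstile> \<phi>"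
  shows "\<Gamma> \<turnstile> \<phi> \<^bold>\<longleftrightarrow> \<psi>"
  using assms by (blast intro: conjI impl_intro)

lemma forall_impl_intro:
  assumes "typed [T] \<phi> Om" and "typed [T] \<psi> Om"
    and "\<And>\<Delta> t. \<Gamma> \<sqsubseteq> \<Delta> \<Longrightarrow> typed [] t T \<Longrightarrow> \<Delta> \<turnstile> \<phi>\<lbrakk>t\<rbrakk> \<Longrightarrow> \<Delta> \<turnstile> \<psi>\<lbrakk>t\<rbrakk>"
  shows "\<Gamma> \<turnstile> Forall T (\<phi> \<^bold>\<longrightarrow> \<psi>)"
proof (rule forall_intro)
  show "typed [T] (\<phi> \<^bold>\<longrightarrow> \<psi>) Om"
    using assms(1,2) by (rule typed.intros)
  fix t assume t: "typed [] t T"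
  have "\<Gamma> \<turnstile> \<phi>\<lbrakk>t\<rbrakk> \<^bold>\<longrightarrow> \<psi>\<lbrakk>t\<rbrakk>"
    by (rule impl_intro[OF typed_subst0[OF assms(1) t] assms(3)[OF _ t]])
  then show "\<Gamma> \<turnstile> (\<phi> \<^bold>\<longrightarrow> \<psi>)\<lbrakk>t\<rbrakk>"
    by simp
qed

lemma forall_impl_elim:
  assumes "\<Gamma> \<turnstile> Forall T (\<phi> \<^bold>\<longrightarrow> \<psi>)" and "typed [] t T" and "\<Gamma> \<turnstile> \<phi>\<lbrakk>t\<rbrakk>"
  shows "\<Gamma> \<turnstile> \<psi>\<lbrakk>t\<rbrakk>"
  using forallE[OF assms(1,2)] assms(3) by (auto intro: implE)

section \<open>Equality\<close>

lemma eqD: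
  assumes "\<Gamma> \<turnstile> s \<approx> t"
  obtains T where "typed [] s T" "typed [] t T"
  using derives_typed[OF assms] by (auto elim: typed_EqualE)

text \<open>
  The formula \<open>\<phi>\<close> with one loose index marks the occurrences that are to be replaced.
\<close>

lemma rewrite:
  assumes "\<Gamma> \<turnstile> s \<approx> t" and "\<Gamma> \<turnstile> \<phi>\<lbrakk>s\<rbrakk>" and "typed [] s T" and "typed [T] \<phi> Om"
  shows "\<Gamma> \<turnstile> \<phi>\<lbrakk>t\<rbrakk>"
proof -
  have "typed [] t T"
    using assms(1,3) by (metis eqD option.inject typed_iff)
  with assms show ?thesis
    by (blast intro: eq_subst)
qed

lemma eq_sym:
  assumes st: "\<Gamma> \<turnstile> s \<approx> t"
  shows "\<Gamma> \<turnstile> t \<approx> s"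
proof -
  obtain T where s: "typed [] s T"
    using st by (rule eqD)
  note [simp] = closedD[OF s]
  show ?thesis
    using rewrite[OF st, of "Bound 0 \<approx> s" T] s refl[OF s, of \<Gamma>] by (simp add: typed_iff)
qed

lemma eq_trans [trans]:
  assumes st: "\<Gamma> \<turnstile> s \<approx> t" and tu: "\<Gamma> \<turnstile> t \<approx> u"
  shows "\<Gamma> \<turnstile> s \<approx> u"
proof -
  obtain T where s: "typed [] s T" and t: "typed [] t T"
    using st by (rule eqD)
  note [simp] = closedD[OF s]
  show ?thesis
    using rewrite[OF tu, of "s \<approx> Bound 0" T] t st by (simp add: typed_iff)
qed

lemma eq_iff: "\<Gamma> \<turnstile> \<phi> \<approx> \<psi> \<Longrightarrow> typed [] \<phi> Om \<Longrightarrow> \<Gamma> \<turnstile> \<phi> \<longleftrightarrow> \<Gamma> \<turnstile> \<psi>"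
  using rewrite[of \<Gamma> \<phi> \<psi> "Bound 0" Om] rewrite[OF eq_sym, of \<Gamma> \<phi> \<psi> "Bound 0" Om]
  by (auto simp: typed_iff elim!: eqD)

lemma eq_App:
  assumes "\<Gamma> \<turnstile> f \<approx> g" and "\<Gamma> \<turnstile> s \<approx> t" and f: "typed [] f (T \<rightarrow>\<^sub>t U)" and s: "typed [] s T"
  shows "\<Gamma> \<turnstile> f \<cdot> s \<approx> g \<cdot> t"
proof -
  note [simp] = closedD[OF f] closedD[OF s]
  have "\<Gamma> \<turnstile> f \<cdot> s \<approx> f \<cdot> s"
    by (rule refl[where T = U]) (simp add: typed_iff)
  then have *: "\<Gamma> \<turnstile> f \<cdot> s \<approx> g \<cdot> s"
    using rewrite[OF assms(1), of "f \<cdot> s \<approx> Bound 0 \<cdot> s" "T \<rightarrow>\<^sub>t U"] f by (simp add: typed_iff)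
  obtain g: "typed [] g (T \<rightarrow>\<^sub>t U)"
    using assms(1) f by (metis eqD option.inject typed_iff)
  note [simp] = closedD[OF g]
  from * show ?thesis
    using rewrite[OF assms(2), of "f \<cdot> s \<approx> g \<cdot> Bound 0" T] s by (simp add: typed_iff)
qed

lemma eq_cong:
  assumes "\<Gamma> \<turnstile> s \<approx> t" and s: "typed [] s T" and u: "typed [T] u U"
  shows "\<Gamma> \<turnstile> u\<lbrakk>s\<rbrakk> \<approx> u\<lbrakk>t\<rbrakk>"
proof -
  have us: "typed [] (u\<lbrakk>s\<rbrakk>) U"
    using u s by (rule typed_subst0)
  note [simp] = closedD[OF us]
  show ?thesis
    using rewrite[OF assms(1), of "u\<lbrakk>s\<rbrakk> \<approx> u" T] refl[OF us, of \<Gamma>] u s by (simp add: typed_iff)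
qed

lemma beta_iff:
  assumes \<phi>: "typed [T] \<phi> Om" and a: "typed [] a T"
  shows "\<Gamma> \<turnstile> Lam T \<phi> \<cdot> a \<longleftrightarrow> \<Gamma> \<turnstile> \<phi>\<lbrakk>a\<rbrakk>"
  by (rule eq_iff[OF beta[OF \<phi> a]]) (use \<phi> a in \<open>simp add: typed_iff\<close>)

section \<open>Arithmetic\<close>

abbreviation plus_tm (infixl "\<^bold>+" 165) where "s \<^bold>+ t \<equiv> add \<cdot> s \<cdot> t"
abbreviation times_tm (infixl "\<^bold>*" 170) where "s \<^bold>* t \<equiv> mul \<cdot> s \<cdot> t"

lemma beta2:
  assumes t: "typed [U, T] t V" and a: "typed [] a T" and b: "typed [] b U"
  shows "\<Gamma> \<turnstile> Lam T (Lam U t) \<cdot> a \<cdot> b \<approx> inst 0 b (inst (Suc 0) a t)"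
proof -
  have t': "typed [U] (inst (Suc 0) a t) V"
    using typed_inst[OF t, of "[U]" T a] a by simp
  have lam: "typed [T] (Lam U t) (U \<rightarrow>\<^sub>t V)"
    using t by (rule typed.intros)
  have "\<Gamma> \<turnstile> Lam T (Lam U t) \<cdot> a \<approx> Lam U (inst (Suc 0) a t)"
    using beta[OF lam a, of \<Gamma>] by simp
  moreover have "typed [] (Lam T (Lam U t) \<cdot> a) (U \<rightarrow>\<^sub>t V)"
    by (rule typed.intros(4)[OF typed.intros(3)[OF lam] a])
  ultimately have "\<Gamma> \<turnstile> Lam T (Lam U t) \<cdot> a \<cdot> b \<approx> Lam U (inst (Suc 0) a t) \<cdot> b"
    using eq_App[OF _ refl[OF b] _ b] by blast
  also have "\<Gamma> \<turnstile> Lam U (inst (Suc 0) a t) \<cdot> b \<approx> inst 0 b (inst (Suc 0) a t)"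
    by (rule beta[OF t' b])
  finally show ?thesis .
qed

lemma eq_refl: "typed [] t N \<Longrightarrow> \<Gamma> \<turnstile> t \<approx> t"
  by (rule refl)

lemma eq_Succ: "\<Gamma> \<turnstile> s \<approx> t \<Longrightarrow> typed [] s N \<Longrightarrow> \<Gamma> \<turnstile> Succ s \<approx> Succ t"
  using eq_cong[of \<Gamma> s t N "Succ (Bound 0)" N] by (simp add: typed_iff)

lemma typed_plus: "typed [] s N \<Longrightarrow> typed [] t N \<Longrightarrow> typed [] (s \<^bold>+ t) N"
  and typed_times: "typed [] s N \<Longrightarrow> typed [] t N \<Longrightarrow> typed [] (s \<^bold>* t) N"
  by (simp_all add: typed_iff)

lemmas typed_arith = typed_plus typed_times typed.intros(8,9)

lemma eq_plus:
  assumes "\<Gamma> \<turnstile> s \<approx> s'" and "\<Gamma> \<turnstile> t \<approx> t'" and "typed [] s N" and "typed [] t N"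
  shows "\<Gamma> \<turnstile> s \<^bold>+ t \<approx> s' \<^bold>+ t'"
  using assms by (intro eq_App[where T = N] refl[OF typed_add]) (auto simp: typed_iff)

lemma eq_times:
  assumes "\<Gamma> \<turnstile> s \<approx> s'" and "\<Gamma> \<turnstile> t \<approx> t'" and "typed [] s N" and "typed [] t N"
  shows "\<Gamma> \<turnstile> s \<^bold>* t \<approx> s' \<^bold>* t'"
  using assms by (intro eq_App[where T = N] refl[OF typed_mul]) (auto simp: typed_iff)

lemma plus_Rec:
  assumes m: "typed [] m N" and n: "typed [] n N"
  shows "\<Gamma> \<turnstile> m \<^bold>+ n \<approx> Rec m (Lam N (Lam N (Succ (Bound 0)))) n"
proof -
  note [simp] = closedD[OF m] closedD[OF n]
  show ?thesis
    using beta2[of N N "Rec (Bound 1) (Lam N (Lam N (Succ (Bound 0)))) (Bound 0)" N m n \<Gamma>] m n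
    by (simp add: add_def binder_defs typed_iff)
qed

lemma times_Rec:
  assumes m: "typed [] m N" and n: "typed [] n N"
  shows "\<Gamma> \<turnstile> m \<^bold>* n \<approx> Rec Zero (Lam N (Lam N (Bound 0 \<^bold>+ m))) n"
proof -
  note [simp] = closedD[OF m] closedD[OF n]
  show ?thesis
    using beta2[of N N "Rec Zero (Lam N (Lam N (Bound 0 \<^bold>+ Bound 3))) (Bound 0)" N m n \<Gamma>] m n
    by (simp add: mul_def binder_defs typed_iff numeral_3_eq_3)
qed

lemma plus_zero: "typed [] m N \<Longrightarrow> \<Gamma> \<turnstile> m \<^bold>+ Zero \<approx> m"
  by (rule eq_trans[OF plus_Rec rec_zero[where T = N]]) (auto simp: typed_iff)

lemma times_zero:
  assumes m: "typed [] m N"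
  shows "\<Gamma> \<turnstile> m \<^bold>* Zero \<approx> Zero"
proof -
  note [simp] = closedD[OF m]
  show ?thesis
    by (rule eq_trans[OF times_Rec rec_zero[where T = N]]) (simp_all add: typed_iff)
qed

lemma plus_Succ:
  assumes m: "typed [] m N" and n: "typed [] n N"
  shows "\<Gamma> \<turnstile> m \<^bold>+ Succ n \<approx> Succ (m \<^bold>+ n)"
proof -
  note [simp] = closedD[OF m] closedD[OF n]
  let ?s = "Lam N (Lam N (Succ (Bound 0)))"
  have "\<Gamma> \<turnstile> m \<^bold>+ Succ n \<approx> Rec m ?s (Succ n)"
    using m n by (intro plus_Rec) (auto simp: typed_iff)
  also have "\<Gamma> \<turnstile> Rec m ?s (Succ n) \<approx> ?s \<cdot> n \<cdot> Rec m ?s n"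
    using m n by (intro rec_succ[where T = N]) (auto simp: typed_iff)
  also have "\<Gamma> \<turnstile> ?s \<cdot> n \<cdot> Rec m ?s n \<approx> Succ (Rec m ?s n)"
    using beta2[of N N "Succ (Bound 0)" N n "Rec m ?s n" \<Gamma>] by (simp add: typed_iff)
  also have "\<Gamma> \<turnstile> Succ (Rec m ?s n) \<approx> Succ (m \<^bold>+ n)"
    by (intro eq_Succ eq_sym[OF plus_Rec] m n) (simp add: typed_iff)
  finally show ?thesis .
qed

lemma times_Succ:
  assumes m: "typed [] m N" and n: "typed [] n N"
  shows "\<Gamma> \<turnstile> m \<^bold>* Succ n \<approx> m \<^bold>* n \<^bold>+ m"
proof -
  note [simp] = closedD[OF m] closedD[OF n]
  let ?s = "Lam N (Lam N (Bound 0 \<^bold>+ m))"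
  have "\<Gamma> \<turnstile> m \<^bold>* Succ n \<approx> Rec Zero ?s (Succ n)"
    using m n by (intro times_Rec) (auto simp: typed_iff)
  also have "\<Gamma> \<turnstile> Rec Zero ?s (Succ n) \<approx> ?s \<cdot> n \<cdot> Rec Zero ?s n"
    using m n by (intro rec_succ[where T = N]) (auto simp: typed_iff)
  also have "\<Gamma> \<turnstile> ?s \<cdot> n \<cdot> Rec Zero ?s n \<approx> Rec Zero ?s n \<^bold>+ m"
    using beta2[of N N "Bound 0 \<^bold>+ m" N n "Rec Zero ?s n" \<Gamma>] by (simp add: typed_iff)
  also have "\<Gamma> \<turnstile> Rec Zero ?s n \<^bold>+ m \<approx> m \<^bold>* n \<^bold>+ m"
    by (intro eq_plus eq_sym[OF times_Rec] refl[of m N] m n) (simp add: typed_iff)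
  finally show ?thesis .
qed

lemma zero_plus:
  assumes n: "typed [] n N"
  shows "\<Gamma> \<turnstile> Zero \<^bold>+ n \<approx> n"
proof -
  have "\<Gamma> \<turnstile> (Zero \<^bold>+ Bound 0 \<approx> Bound 0)\<lbrakk>n\<rbrakk>"
  proof (rule induct_nat)
    fix \<Delta> m assume m: "typed [] m N" and IH: "\<Delta> \<turnstile> (Zero \<^bold>+ Bound 0 \<approx> Bound 0)\<lbrakk>m\<rbrakk>"
    have "\<Delta> \<turnstile> Zero \<^bold>+ Succ m \<approx> Succ (Zero \<^bold>+ m)"
      by (intro plus_Succ m typed_arith)
    also have "\<Delta> \<turnstile> Succ (Zero \<^bold>+ m) \<approx> Succ m"
      using IH by (intro eq_Succ m typed_arith) simp
    finally show "\<Delta> \<turnstile> (Zero \<^bold>+ Bound 0 \<approx> Bound 0)\<lbrakk>Succ m\<rbrakk>" by simp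
  qed (use n plus_zero in \<open>auto simp: typed_iff\<close>)
  then show ?thesis by simp
qed

lemma Succ_plus:
  assumes m: "typed [] m N" and n: "typed [] n N"
  shows "\<Gamma> \<turnstile> Succ m \<^bold>+ n \<approx> Succ (m \<^bold>+ n)"
proof -
  note [simp] = closedD[OF m]
  let ?\<phi> = "Succ m \<^bold>+ Bound 0 \<approx> Succ (m \<^bold>+ Bound 0)"
  have "\<Gamma> \<turnstile> ?\<phi>\<lbrakk>n\<rbrakk>"
  proof (rule induct_nat)
    have "\<Gamma> \<turnstile> Succ m \<^bold>+ Zero \<approx> Succ m"
      by (intro plus_zero m typed_arith)
    also have "\<Gamma> \<turnstile> Succ m \<approx> Succ (m \<^bold>+ Zero)"
      by (intro eq_Succ eq_sym[OF plus_zero] m)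
    finally show "\<Gamma> \<turnstile> ?\<phi>\<lbrakk>Zero\<rbrakk>" by simp
  next
    fix \<Delta> k assume k: "typed [] k N" and IH: "\<Delta> \<turnstile> ?\<phi>\<lbrakk>k\<rbrakk>"
    have "\<Delta> \<turnstile> Succ m \<^bold>+ Succ k \<approx> Succ (Succ m \<^bold>+ k)"
      by (intro plus_Succ m k typed_arith)
    also have "\<Delta> \<turnstile> Succ (Succ m \<^bold>+ k) \<approx> Succ (Succ (m \<^bold>+ k))"
      using IH by (intro eq_Succ m k typed_arith) simp
    also have "\<Delta> \<turnstile> Succ (Succ (m \<^bold>+ k)) \<approx> Succ (m \<^bold>+ Succ k)"
      by (intro eq_Succ eq_sym[OF plus_Succ] m k typed_arith)
    finally show "\<Delta> \<turnstile> ?\<phi>\<lbrakk>Succ k\<rbrakk>" by simp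
  qed (use n in \<open>auto simp: typed_iff\<close>)
  then show ?thesis by simp
qed

lemma plus_comm:
  assumes m: "typed [] m N" and n: "typed [] n N"
  shows "\<Gamma> \<turnstile> m \<^bold>+ n \<approx> n \<^bold>+ m"
proof -
  note [simp] = closedD[OF m]
  let ?\<phi> = "m \<^bold>+ Bound 0 \<approx> Bound 0 \<^bold>+ m"
  have "\<Gamma> \<turnstile> ?\<phi>\<lbrakk>n\<rbrakk>"
  proof (rule induct_nat)
    show "\<Gamma> \<turnstile> ?\<phi>\<lbrakk>Zero\<rbrakk>"
      using eq_trans[OF plus_zero[OF m] eq_sym[OF zero_plus[OF m]]] by simp
  next
    fix \<Delta> k assume k: "typed [] k N" and IH: "\<Delta> \<turnstile> ?\<phi>\<lbrakk>k\<rbrakk>"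
    have "\<Delta> \<turnstile> m \<^bold>+ Succ k \<approx> Succ (m \<^bold>+ k)"
      by (intro plus_Succ m k typed_arith)
    also have "\<Delta> \<turnstile> Succ (m \<^bold>+ k) \<approx> Succ (k \<^bold>+ m)"
      using IH by (intro eq_Succ m k typed_arith) simp
    also have "\<Delta> \<turnstile> Succ (k \<^bold>+ m) \<approx> Succ k \<^bold>+ m"
      by (intro eq_sym[OF Succ_plus] m k typed_arith)
    finally show "\<Delta> \<turnstile> ?\<phi>\<lbrakk>Succ k\<rbrakk>" by simp
  qed (use n in \<open>auto simp: typed_iff\<close>)
  then show ?thesis by simp
qed

lemma plus_assoc:
  assumes k: "typed [] k N" and m: "typed [] m N" and n: "typed [] n N"
  shows "\<Gamma> \<turnstile> k \<^bold>+ m \<^bold>+ n \<approx> k \<^bold>+ (m \<^bold>+ n)"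
proof -
  note [simp] = closedD[OF k] closedD[OF m]
  let ?\<phi> = "k \<^bold>+ m \<^bold>+ Bound 0 \<approx> k \<^bold>+ (m \<^bold>+ Bound 0)"
  have "\<Gamma> \<turnstile> ?\<phi>\<lbrakk>n\<rbrakk>"
  proof (rule induct_nat)
    have "\<Gamma> \<turnstile> k \<^bold>+ m \<^bold>+ Zero \<approx> k \<^bold>+ m"
      by (intro plus_zero k m typed_arith)
    also have "\<Gamma> \<turnstile> k \<^bold>+ m \<approx> k \<^bold>+ (m \<^bold>+ Zero)"
      by (intro eq_plus refl[of k N] eq_sym[OF plus_zero] k m typed_arith)
    finally show "\<Gamma> \<turnstile> ?\<phi>\<lbrakk>Zero\<rbrakk>" by simp
  next
    fix \<Delta> l assume l: "typed [] l N" and IH: "\<Delta> \<turnstile> ?\<phi>\<lbrakk>l\<rbrakk>"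
    have "\<Delta> \<turnstile> k \<^bold>+ m \<^bold>+ Succ l \<approx> Succ (k \<^bold>+ m \<^bold>+ l)"
      by (intro plus_Succ k m l typed_arith)
    also have "\<Delta> \<turnstile> Succ (k \<^bold>+ m \<^bold>+ l) \<approx> Succ (k \<^bold>+ (m \<^bold>+ l))"
      using IH by (intro eq_Succ k m l typed_arith) simp
    also have "\<Delta> \<turnstile> Succ (k \<^bold>+ (m \<^bold>+ l)) \<approx> k \<^bold>+ Succ (m \<^bold>+ l)"
      by (intro eq_sym[OF plus_Succ] k m l typed_arith)
    also have "\<Delta> \<turnstile> k \<^bold>+ Succ (m \<^bold>+ l) \<approx> k \<^bold>+ (m \<^bold>+ Succ l)"
      by (intro eq_plus refl[of k N] eq_sym[OF plus_Succ] k m l typed_arith)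
    finally show "\<Delta> \<turnstile> ?\<phi>\<lbrakk>Succ l\<rbrakk>" by simp
  qed (use n in \<open>auto simp: typed_iff\<close>)
  then show ?thesis by simp
qed

lemma plus_right_comm:
  assumes k: "typed [] k N" and m: "typed [] m N" and n: "typed [] n N"
  shows "\<Gamma> \<turnstile> k \<^bold>+ m \<^bold>+ n \<approx> k \<^bold>+ n \<^bold>+ m"
proof -
  have "\<Gamma> \<turnstile> k \<^bold>+ m \<^bold>+ n \<approx> k \<^bold>+ (m \<^bold>+ n)"
    by (intro plus_assoc assms)
  also have "\<Gamma> \<turnstile> k \<^bold>+ (m \<^bold>+ n) \<approx> k \<^bold>+ (n \<^bold>+ m)"
    by (intro eq_plus refl[of k N] plus_comm assms typed_arith)
  also have "\<Gamma> \<turnstile> k \<^bold>+ (n \<^bold>+ m) \<approx> k \<^bold>+ n \<^bold>+ m"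
    by (intro eq_sym[OF plus_assoc] assms)
  finally show ?thesis .
qed

lemma distrib:
  assumes k: "typed [] k N" and m: "typed [] m N" and n: "typed [] n N"
  shows "\<Gamma> \<turnstile> k \<^bold>* (m \<^bold>+ n) \<approx> k \<^bold>* m \<^bold>+ k \<^bold>* n"
proof -
  note [simp] = closedD[OF k] closedD[OF m]
  let ?\<phi> = "k \<^bold>* (m \<^bold>+ Bound 0) \<approx> k \<^bold>* m \<^bold>+ k \<^bold>* Bound 0"
  have "\<Gamma> \<turnstile> ?\<phi>\<lbrakk>n\<rbrakk>"
  proof (rule induct_nat)
    have "\<Gamma> \<turnstile> k \<^bold>* (m \<^bold>+ Zero) \<approx> k \<^bold>* m"
      by (intro eq_times refl[of k N] plus_zero k m typed_arith)
    also have "\<Gamma> \<turnstile> k \<^bold>* m \<approx> k \<^bold>* m \<^bold>+ Zero"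
      by (intro eq_sym[OF plus_zero] k m typed_arith)
    also have "\<Gamma> \<turnstile> k \<^bold>* m \<^bold>+ Zero \<approx> k \<^bold>* m \<^bold>+ k \<^bold>* Zero"
      by (intro eq_plus refl[of "k \<^bold>* m" N] eq_sym[OF times_zero] k m typed_arith)
    finally show "\<Gamma> \<turnstile> ?\<phi>\<lbrakk>Zero\<rbrakk>" by simp
  next
    fix \<Delta> l assume l: "typed [] l N" and IH: "\<Delta> \<turnstile> ?\<phi>\<lbrakk>l\<rbrakk>"
    have "\<Delta> \<turnstile> k \<^bold>* (m \<^bold>+ Succ l) \<approx> k \<^bold>* Succ (m \<^bold>+ l)"
      by (intro eq_times refl[of k N] plus_Succ k m l typed_arith)
    also have "\<Delta> \<turnstile> k \<^bold>* Succ (m \<^bold>+ l) \<approx> k \<^bold>* (m \<^bold>+ l) \<^bold>+ k"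
      by (intro times_Succ k m l typed_arith)
    also have "\<Delta> \<turnstile> k \<^bold>* (m \<^bold>+ l) \<^bold>+ k \<approx> k \<^bold>* m \<^bold>+ k \<^bold>* l \<^bold>+ k"
      using IH by (intro eq_plus refl[of k N] k m l typed_arith) simp
    also have "\<Delta> \<turnstile> k \<^bold>* m \<^bold>+ k \<^bold>* l \<^bold>+ k \<approx> k \<^bold>* m \<^bold>+ (k \<^bold>* l \<^bold>+ k)"
      by (intro plus_assoc k m l typed_arith)
    also have "\<Delta> \<turnstile> k \<^bold>* m \<^bold>+ (k \<^bold>* l \<^bold>+ k) \<approx> k \<^bold>* m \<^bold>+ k \<^bold>* Succ l"
      by (intro eq_plus refl[of "k \<^bold>* m" N] eq_sym[OF times_Succ] k m l typed_arith)
    finally show "\<Delta> \<turnstile> ?\<phi>\<lbrakk>Succ l\<rbrakk>" by simp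
  qed (use n in \<open>auto simp: typed_iff\<close>)
  then show ?thesis by simp
qed

lemma times_assoc:
  assumes k: "typed [] k N" and m: "typed [] m N" and n: "typed [] n N"
  shows "\<Gamma> \<turnstile> k \<^bold>* m \<^bold>* n \<approx> k \<^bold>* (m \<^bold>* n)"
proof -
  note [simp] = closedD[OF k] closedD[OF m]
  let ?\<phi> = "k \<^bold>* m \<^bold>* Bound 0 \<approx> k \<^bold>* (m \<^bold>* Bound 0)"
  have "\<Gamma> \<turnstile> ?\<phi>\<lbrakk>n\<rbrakk>"
  proof (rule induct_nat)
    have "\<Gamma> \<turnstile> k \<^bold>* m \<^bold>* Zero \<approx> Zero"
      by (intro times_zero k m typed_arith)
    also have "\<Gamma> \<turnstile> Zero \<approx> k \<^bold>* Zero"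
      by (intro eq_sym[OF times_zero] k m typed_arith)
    also have "\<Gamma> \<turnstile> k \<^bold>* Zero \<approx> k \<^bold>* (m \<^bold>* Zero)"
      by (intro eq_times refl[of k N] eq_sym[OF times_zero] k m typed_arith)
    finally show "\<Gamma> \<turnstile> ?\<phi>\<lbrakk>Zero\<rbrakk>" by simp
  next
    fix \<Delta> l assume l: "typed [] l N" and IH: "\<Delta> \<turnstile> ?\<phi>\<lbrakk>l\<rbrakk>"
    have "\<Delta> \<turnstile> k \<^bold>* m \<^bold>* Succ l \<approx> k \<^bold>* m \<^bold>* l \<^bold>+ k \<^bold>* m"
      by (intro times_Succ k m l typed_arith)
    also have "\<Delta> \<turnstile> k \<^bold>* m \<^bold>* l \<^bold>+ k \<^bold>* m \<approx> k \<^bold>* (m \<^bold>* l) \<^bold>+ k \<^bold>* m"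
      using IH by (intro eq_plus refl[of "k \<^bold>* m" N] k m l typed_arith) simp
    also have "\<Delta> \<turnstile> k \<^bold>* (m \<^bold>* l) \<^bold>+ k \<^bold>* m \<approx> k \<^bold>* (m \<^bold>* l \<^bold>+ m)"
      by (intro eq_sym[OF distrib] k m l typed_arith)
    also have "\<Delta> \<turnstile> k \<^bold>* (m \<^bold>* l \<^bold>+ m) \<approx> k \<^bold>* (m \<^bold>* Succ l)"
      by (intro eq_times refl[of k N] eq_sym[OF times_Succ] k m l typed_arith)
    finally show "\<Delta> \<turnstile> ?\<phi>\<lbrakk>Succ l\<rbrakk>" by simp
  qed (use n in \<open>auto simp: typed_iff\<close>)
  then show ?thesis by simp
qed

lemma zero_times:
  assumes n: "typed [] n N"
  shows "\<Gamma> \<turnstile> Zero \<^bold>* n \<approx> Zero"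
proof -
  have "\<Gamma> \<turnstile> (Zero \<^bold>* Bound 0 \<approx> Zero)\<lbrakk>n\<rbrakk>"
  proof (rule induct_nat)
    fix \<Delta> m assume m: "typed [] m N" and IH: "\<Delta> \<turnstile> (Zero \<^bold>* Bound 0 \<approx> Zero)\<lbrakk>m\<rbrakk>"
    have "\<Delta> \<turnstile> Zero \<^bold>* Succ m \<approx> Zero \<^bold>* m \<^bold>+ Zero"
      by (intro times_Succ m typed_arith)
    also have "\<Delta> \<turnstile> Zero \<^bold>* m \<^bold>+ Zero \<approx> Zero \<^bold>* m"
      by (intro plus_zero m typed_arith)
    also have "\<Delta> \<turnstile> Zero \<^bold>* m \<approx> Zero"
      using IH by simp
    finally show "\<Delta> \<turnstile> (Zero \<^bold>* Bound 0 \<approx> Zero)\<lbrakk>Succ m\<rbrakk>" by simp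
  qed (use n times_zero in \<open>auto simp: typed_iff\<close>)
  then show ?thesis by simp
qed

lemma Succ_times:
  assumes m: "typed [] m N" and n: "typed [] n N"
  shows "\<Gamma> \<turnstile> Succ m \<^bold>* n \<approx> m \<^bold>* n \<^bold>+ n"
proof -
  note [simp] = closedD[OF m]
  let ?\<phi> = "Succ m \<^bold>* Bound 0 \<approx> m \<^bold>* Bound 0 \<^bold>+ Bound 0"
  have "\<Gamma> \<turnstile> ?\<phi>\<lbrakk>n\<rbrakk>"
  proof (rule induct_nat)
    have "\<Gamma> \<turnstile> Succ m \<^bold>* Zero \<approx> Zero"
      by (intro times_zero m typed_arith)
    also have "\<Gamma> \<turnstile> Zero \<approx> m \<^bold>* Zero"
      by (intro eq_sym[OF times_zero] m typed_arith)
    also have "\<Gamma> \<turnstile> m \<^bold>* Zero \<approx> m \<^bold>* Zero \<^bold>+ Zero"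
      by (intro eq_sym[OF plus_zero] m typed_arith)
    finally show "\<Gamma> \<turnstile> ?\<phi>\<lbrakk>Zero\<rbrakk>" by simp
  next
    fix \<Delta> k assume k: "typed [] k N" and IH: "\<Delta> \<turnstile> ?\<phi>\<lbrakk>k\<rbrakk>"
    have "\<Delta> \<turnstile> Succ m \<^bold>* Succ k \<approx> Succ m \<^bold>* k \<^bold>+ Succ m"
      by (intro times_Succ m k typed_arith)
    also have "\<Delta> \<turnstile> Succ m \<^bold>* k \<^bold>+ Succ m \<approx> m \<^bold>* k \<^bold>+ k \<^bold>+ Succ m"
      using IH by (intro eq_plus refl[of "Succ m" N] m k typed_arith) simp
    also have "\<Delta> \<turnstile> m \<^bold>* k \<^bold>+ k \<^bold>+ Succ m \<approx> Succ (m \<^bold>* k \<^bold>+ k \<^bold>+ m)"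
      by (intro plus_Succ m k typed_arith)
    also have "\<Delta> \<turnstile> Succ (m \<^bold>* k \<^bold>+ k \<^bold>+ m) \<approx> Succ (m \<^bold>* k \<^bold>+ m \<^bold>+ k)"
      by (intro eq_Succ plus_right_comm m k typed_arith)
    also have "\<Delta> \<turnstile> Succ (m \<^bold>* k \<^bold>+ m \<^bold>+ k) \<approx> m \<^bold>* k \<^bold>+ m \<^bold>+ Succ k"
      by (intro eq_sym[OF plus_Succ] m k typed_arith)
    also have "\<Delta> \<turnstile> m \<^bold>* k \<^bold>+ m \<^bold>+ Succ k \<approx> m \<^bold>* Succ k \<^bold>+ Succ k"
      by (intro eq_plus eq_sym[OF times_Succ] refl[of "Succ k" N] m k typed_arith)
    finally show "\<Delta> \<turnstile> ?\<phi>\<lbrakk>Succ k\<rbrakk>" by simp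
  qed (use n in \<open>auto simp: typed_iff\<close>)
  then show ?thesis by simp
qed

lemma times_comm:
  assumes m: "typed [] m N" and n: "typed [] n N"
  shows "\<Gamma> \<turnstile> m \<^bold>* n \<approx> n \<^bold>* m"
proof -
  note [simp] = closedD[OF m]
  let ?\<phi> = "m \<^bold>* Bound 0 \<approx> Bound 0 \<^bold>* m"
  have "\<Gamma> \<turnstile> ?\<phi>\<lbrakk>n\<rbrakk>"
  proof (rule induct_nat)
    show "\<Gamma> \<turnstile> ?\<phi>\<lbrakk>Zero\<rbrakk>"
      using eq_trans[OF times_zero[OF m] eq_sym[OF zero_times[OF m]]] by simp
  next
    fix \<Delta> k assume k: "typed [] k N" and IH: "\<Delta> \<turnstile> ?\<phi>\<lbrakk>k\<rbrakk>"
    have "\<Delta> \<turnstile> m \<^bold>* Succ k \<approx> m \<^bold>* k \<^bold>+ m"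
      by (intro times_Succ m k)
    also have "\<Delta> \<turnstile> m \<^bold>* k \<^bold>+ m \<approx> k \<^bold>* m \<^bold>+ m"
      using IH by (intro eq_plus refl[of m N] m k typed_arith) simp
    also have "\<Delta> \<turnstile> k \<^bold>* m \<^bold>+ m \<approx> Succ k \<^bold>* m"
      by (intro eq_sym[OF Succ_times] m k typed_arith)
    finally show "\<Delta> \<turnstile> ?\<phi>\<lbrakk>Succ k\<rbrakk>" by simp
  qed (use n in \<open>auto simp: typed_iff\<close>)
  then show ?thesis by simp
qed

text \<open>
  Induction starting at \<open>n\<close>. The induction is on \<open>j\<close>, and the formula is hidden behind a
  \<open>Lam\<close> because its loose index would otherwise have to be replaced by the open term
  \<open>n \<^bold>+ Bound 0\<close>.
\<close>

lemma induct_from: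
  assumes \<psi>: "typed [N] \<psi> Om" and n: "typed [] n N" and j: "typed [] j N" and base: "\<Gamma> \<turnstile> \<psi>\<lbrakk>n\<rbrakk>"
    and step: "\<And>\<Delta> m. \<Gamma> \<sqsubseteq> \<Delta> \<Longrightarrow> typed [] m N \<Longrightarrow> \<Delta> \<turnstile> \<psi>\<lbrakk>m\<rbrakk> \<Longrightarrow> \<Delta> \<turnstile> \<psi>\<lbrakk>Succ m\<rbrakk>"
  shows "\<Gamma> \<turnstile> \<psi>\<lbrakk>n \<^bold>+ j\<rbrakk>"
proof -
  note [simp] = closedD[OF n]
  let ?\<phi> = "Lam N \<psi> \<cdot> (n \<^bold>+ Bound 0)"
  have lam: "typed [] (Lam N \<psi>) (N \<rightarrow>\<^sub>t Om)"
    using \<psi> by (rule typed.intros)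
  note [simp del] = inst.simps(3) type_of.simps(3) and [simp] = closedD[OF lam]
  have \<phi>: "\<Delta> \<turnstile> ?\<phi>\<lbrakk>m\<rbrakk> \<longleftrightarrow> \<Delta> \<turnstile> \<psi>\<lbrakk>n \<^bold>+ m\<rbrakk>" if m: "typed [] m N" for \<Delta> m
    using beta_iff[OF \<psi> typed_plus[OF n m]] by simp
  have "\<Gamma> \<turnstile> ?\<phi>\<lbrakk>j\<rbrakk>"
  proof (rule induct_nat)
    have zero: "typed [] Zero N"
      by (intro typed_arith)
    show "\<Gamma> \<turnstile> ?\<phi>\<lbrakk>Zero\<rbrakk>"
      unfolding \<phi>[OF zero] by (rule rewrite[OF eq_sym[OF plus_zero[OF n]] base n \<psi>])
  next
    fix \<Delta> m assume \<Delta>: "\<Gamma> \<sqsubseteq> \<Delta>" and m: "typed [] m N" and IH: "\<Delta> \<turnstile> ?\<phi>\<lbrakk>m\<rbrakk>"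
    have "\<Delta> \<turnstile> \<psi>\<lbrakk>Succ (n \<^bold>+ m)\<rbrakk>"
      using IH unfolding \<phi>[OF m] by (intro step[OF \<Delta>] typed_arith n m)
    then show "\<Delta> \<turnstile> ?\<phi>\<lbrakk>Succ m\<rbrakk>"
      unfolding \<phi>[OF typed.intros(9)[OF m]]
      by (rule rewrite[OF eq_sym[OF plus_Succ[OF n m]] _ _ \<psi>]) (intro typed_arith n m)
  qed (use j in \<open>simp_all add: typed_iff\<close>)
  then show ?thesis
    unfolding \<phi>[OF j] .
qed

section \<open>Numerical terms as a semiring\<close>

lemma one_times:
  assumes n: "typed [] n N"
  shows "\<Gamma> \<turnstile> Succ Zero \<^bold>* n \<approx> n"
proof -
  have "\<Gamma> \<turnstile> Succ Zero \<^bold>* n \<approx> Zero \<^bold>* n \<^bold>+ n"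
    by (intro Succ_times n typed_arith)
  also have "\<Gamma> \<turnstile> Zero \<^bold>* n \<^bold>+ n \<approx> Zero \<^bold>+ n"
    by (intro eq_plus zero_times refl[OF n] n typed_arith)
  also have "\<Gamma> \<turnstile> Zero \<^bold>+ n \<approx> n"
    by (rule zero_plus[OF n])
  finally show ?thesis .
qed

lemma times_distrib:
  assumes k: "typed [] k N" and m: "typed [] m N" and n: "typed [] n N"
  shows "\<Gamma> \<turnstile> (k \<^bold>+ m) \<^bold>* n \<approx> k \<^bold>* n \<^bold>+ m \<^bold>* n"
proof -
  have "\<Gamma> \<turnstile> (k \<^bold>+ m) \<^bold>* n \<approx> n \<^bold>* (k \<^bold>+ m)"
    by (intro times_comm assms typed_arith)
  also have "\<Gamma> \<turnstile> n \<^bold>* (k \<^bold>+ m) \<approx> n \<^bold>* k \<^bold>+ n \<^bold>* m"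
    by (intro distrib assms)
  also have "\<Gamma> \<turnstile> n \<^bold>* k \<^bold>+ n \<^bold>* m \<approx> k \<^bold>* n \<^bold>+ m \<^bold>* n"
    by (intro eq_plus times_comm assms typed_arith)
  finally show ?thesis .
qed

text \<open>
  Numerical terms modulo provable equality in the empty context form a commutative semiring, so
  identities between object-level terms are proved by normalizing polynomials in the metalogic. The type
  is an instance of \<^class>\<open>comm_semiring_0\<close> and \<^class>\<open>comm_monoid_mult\<close>, not of a class in
  which zero and one differ, because their being different is the consistency of the calculus.
\<close>

quotient_type nat_class = tm / partial: "\<lambda>s t. typed [] s N \<and> typed [] t N \<and> [] \<turnstile> s \<approx> t"
proof (rule part_equivpI)
  have "typed [] Zero N" by (rule typed.intros)
  then show "\<exists>t. typed [] t N \<and> typed [] t N \<and> [] \<turnstile> t \<approx> t"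
    using refl by blast
  show "symp (\<lambda>s t. typed [] s N \<and> typed [] t N \<and> [] \<turnstile> s \<approx> t)"
    by (rule sympI) (blast intro: eq_sym)
  show "transp (\<lambda>s t. typed [] s N \<and> typed [] t N \<and> [] \<turnstile> s \<approx> t)"
    by (rule transpI) (blast intro: eq_trans)
qed

instantiation nat_class :: "{comm_semiring_0, comm_monoid_mult}"
begin

lift_definition zero_nat_class :: nat_class is Zero
  using refl by (simp add: typed_iff)

lift_definition one_nat_class :: nat_class is "Succ Zero"
  using refl by (simp add: typed_iff)

lift_definition plus_nat_class :: "nat_class \<Rightarrow> nat_class \<Rightarrow> nat_class" is "\<lambda>s t. s \<^bold>+ t"
  by (simp add: typed_plus eq_plus)

lift_definition times_nat_class :: "nat_class \<Rightarrow> nat_class \<Rightarrow> nat_class" is "\<lambda>s t. s \<^bold>* t"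
  by (simp add: typed_times eq_times)

instance
proof
  fix a b c :: nat_class
  show "a + b + c = a + (b + c)"
    by transfer (auto intro: plus_assoc typed_arith)
  show "a + b = b + a"
    by transfer (auto intro: plus_comm typed_arith)
  show "0 + a = a"
    by transfer (auto intro: zero_plus typed_arith)
  show "a * b * c = a * (b * c)"
    by transfer (auto intro: times_assoc typed_arith)
  show "a * b = b * a"
    by transfer (auto intro: times_comm typed_arith)
  show "0 * a = 0"
    by transfer (auto intro: zero_times typed_arith)
  show "a * 0 = 0"
    by transfer (auto intro: times_zero typed_arith)
  show "1 * a = a"
    by transfer (auto intro: one_times typed_arith)
  show "(a + b) * c = a * c + b * c"
    by transfer (auto intro: times_distrib typed_arith)
qed

end

abbreviation cls :: "tm \<Rightarrow> nat_class" where
  "cls \<equiv> abs_nat_class"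

text \<open>
  The way back from the quotient: a semiring identity is derivable in every context.
\<close>

lemma cls_eq: "cls s = cls t \<Longrightarrow> typed [] s N \<Longrightarrow> typed [] t N \<Longrightarrow> \<Gamma> \<turnstile> s \<approx> t"
  using Quotient3_rel[OF Quotient3_nat_class, of s t] weakening[of "[]" "s \<approx> t" \<Gamma>]
  by (auto simp: refl weaker_def)

lemma Succ_plus_one:
  assumes "typed [] n N"
  shows "\<Gamma> \<turnstile> n \<^bold>+ Succ Zero \<approx> Succ n"
  using assms by (intro eq_trans[OF plus_Succ eq_Succ[OF plus_zero]] typed_arith)

lemma cls_simps:
  "cls Zero = 0"
  "typed [] s N \<Longrightarrow> typed [] t N \<Longrightarrow> cls (s \<^bold>+ t) = cls s + cls t"
  "typed [] s N \<Longrightarrow> typed [] t N \<Longrightarrow> cls (s \<^bold>* t) = cls s * cls t"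
  "typed [] s N \<Longrightarrow> cls (Succ s) = cls s + 1"
proof -
  show "cls Zero = 0"
    by (simp add: zero_nat_class_def)
  show plus: "cls (s \<^bold>+ t) = cls s + cls t" if "typed [] s N" "typed [] t N" for s t
    using that by (simp add: plus_nat_class.abs_eq eq_onp_def refl)
  show "cls (s \<^bold>* t) = cls s * cls t" if "typed [] s N" "typed [] t N"
    using that by (simp add: times_nat_class.abs_eq eq_onp_def refl)
  show "cls (Succ s) = cls s + 1" if "typed [] s N"
  proof -
    have "cls (Succ s) = cls (s \<^bold>+ Succ Zero)"
      using that Quotient3_rel[OF Quotient3_nat_class, of "Succ s" "s \<^bold>+ Succ Zero"]
      by (auto intro: typed_arith refl eq_sym[OF Succ_plus_one])
    also have "\<dots> = cls s + 1"
      using that by (simp add: plus one_nat_class_def typed_arith)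
    finally show ?thesis .
  qed
qed

section \<open>Order\<close>

text \<open>
  Inequalities are refuted by reducing them to an equation of this form.
\<close>

lemma no_self_plus:
  assumes eq: "\<Gamma> \<turnstile> n \<approx> n \<^bold>+ Succ k" and n: "typed [] n N" and k: "typed [] k N"
  shows "\<Gamma> \<turnstile> Falsum"
proof -
  note [simp] = closedD[OF k]
  let ?\<phi> = "Bound 0 \<approx> Bound 0 \<^bold>+ Succ k \<^bold>\<longrightarrow> Falsum"
  have "\<Gamma> \<turnstile> ?\<phi>\<lbrakk>n\<rbrakk>"
  proof (rule induct_nat)
    have "\<Delta> \<turnstile> Falsum" if "\<Delta> \<turnstile> Zero \<approx> Zero \<^bold>+ Succ k" for \<Delta>
    proof (rule implE[OF succ_not_zero[OF k]])
      show "\<Delta> \<turnstile> Succ k \<approx> Zero"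
        by (rule eq_sym[OF eq_trans[OF that zero_plus]]) (intro typed_arith k)
    qed
    then show "\<Gamma> \<turnstile> ?\<phi>\<lbrakk>Zero\<rbrakk>"
      using k by (auto intro!: impl_intro simp: typed_iff)
  next
    fix \<Delta> m assume m: "typed [] m N" and IH: "\<Delta> \<turnstile> ?\<phi>\<lbrakk>m\<rbrakk>"
    have "\<Theta> \<turnstile> Falsum" if \<Theta>: "\<Delta> \<sqsubseteq> \<Theta>" and eq: "\<Theta> \<turnstile> Succ m \<approx> Succ m \<^bold>+ Succ k" for \<Theta>
    proof (rule implE)
      show "\<Theta> \<turnstile> m \<approx> m \<^bold>+ Succ k \<^bold>\<longrightarrow> Falsum"
        using weakening[OF IH \<Theta>] by simp
      show "\<Theta> \<turnstile> m \<approx> m \<^bold>+ Succ k"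
        by (rule succ_inj, rule eq_trans[OF eq Succ_plus]) (intro typed_arith k m)+
    qed
    then show "\<Delta> \<turnstile> ?\<phi>\<lbrakk>Succ m\<rbrakk>"
      using k m by (auto intro!: impl_intro simp: typed_iff)
  qed (use n in \<open>auto simp: typed_iff\<close>)
  then show ?thesis
    using eq by (auto intro: implE)
qed

text \<open>
  An object-level constant rather than an abbreviation for its existential formula, so that it can be
  applied to bound variables without shifting indices.
\<close>

definition leq_nat :: tm where
  "leq_nat = Lam N (Lam N (Exists N (Bound 1 \<approx> Bound 2 \<^bold>+ Bound 0)))"

lemma typed_leq_nat: "typed [] leq_nat (N \<rightarrow>\<^sub>t N \<rightarrow>\<^sub>t Om)"
  by (simp add: leq_nat_def typed_iff numeral_2_eq_2)

lemmas closed_leq_nat [simp] = closedD[OF typed_leq_nat]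

lemma leq_nat_unfold:
  assumes m: "typed [] m N" and n: "typed [] n N"
  shows "\<Gamma> \<turnstile> leq_nat \<cdot> m \<cdot> n \<longleftrightarrow> \<Gamma> \<turnstile> Exists N (n \<approx> m \<^bold>+ Bound 0)"
proof -
  note [simp] = closedD[OF m] closedD[OF n]
  have "\<Gamma> \<turnstile> leq_nat \<cdot> m \<cdot> n \<approx> Exists N (n \<approx> m \<^bold>+ Bound 0)"
    using beta2[of N N "Exists N (Bound 1 \<approx> Bound 2 \<^bold>+ Bound 0)" Om m n \<Gamma>] m n
    by (simp add: leq_nat_def typed_iff numeral_2_eq_2)
  then show ?thesis
    by (rule eq_iff) (simp add: typed_iff)
qed

lemma leq_natI:
  assumes m: "typed [] m N" and n: "typed [] n N" and k: "typed [] k N" and eq: "\<Gamma> \<turnstile> n \<approx> m \<^bold>+ k"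
  shows "\<Gamma> \<turnstile> leq_nat \<cdot> m \<cdot> n"
proof -
  note [simp] = closedD[OF m] closedD[OF n]
  show ?thesis
    unfolding leq_nat_unfold[OF m n] by (rule existsI[OF _ k]) (simp_all add: typed_iff eq)
qed

lemma leq_natE:
  assumes m: "typed [] m N" and n: "typed [] n N" and leq: "\<Gamma> \<turnstile> leq_nat \<cdot> m \<cdot> n"
    and step: "\<And>\<Delta> k. \<Gamma> \<sqsubseteq> \<Delta> \<Longrightarrow> typed [] k N \<Longrightarrow> \<Delta> \<turnstile> n \<approx> m \<^bold>+ k \<Longrightarrow> \<Delta> \<turnstile> \<psi>"
  shows "\<Gamma> \<turnstile> \<psi>"
proof -
  note [simp] = closedD[OF m] closedD[OF n]
  show ?thesis
    by (rule exists_elim[OF leq[unfolded leq_nat_unfold[OF m n]]]) (use step in simp)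
qed

lemma less_nat_unfold:
  assumes m: "typed [] m N" and n: "typed [] n N"
  shows "\<Gamma> \<turnstile> less_nat \<cdot> m \<cdot> n \<approx> Exists N (n \<approx> m \<^bold>+ Succ (Bound 0))"
proof -
  note [simp] = closedD[OF m] closedD[OF n]
  show ?thesis
    using beta2[of N N "Exists N (Bound 1 \<approx> Bound 2 \<^bold>+ Succ (Bound 0))" Om m n \<Gamma>] m n
    by (simp add: less_nat_def binder_defs typed_iff numeral_2_eq_2)
qed

lemma eq_less_nat:
  assumes "\<Gamma> \<turnstile> s \<approx> s'" and "\<Gamma> \<turnstile> t \<approx> t'" and "typed [] s N" and "typed [] t N"
  shows "\<Gamma> \<turnstile> less_nat \<cdot> s \<cdot> t \<approx> less_nat \<cdot> s' \<cdot> t'"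
  using assms by (intro eq_App[where T = N] refl[OF typed_less_nat]) (auto simp: typed_iff)

text \<open>
  The representative of \<open>a / (c + 1)\<close>.
\<close>

abbreviation frac :: "tm \<Rightarrow> tm \<Rightarrow> tm" where
  "frac a c \<equiv> Pair a (Pair Zero c)"

lemma eq_Fst: "\<Gamma> \<turnstile> s \<approx> t \<Longrightarrow> typed [] s (T \<times>\<^sub>t U) \<Longrightarrow> \<Gamma> \<turnstile> Fst s \<approx> Fst t"
  using eq_cong[of \<Gamma> s t "T \<times>\<^sub>t U" "Fst (Bound 0)" T] by (simp add: typed_iff)

lemma eq_Snd: "\<Gamma> \<turnstile> s \<approx> t \<Longrightarrow> typed [] s (T \<times>\<^sub>t U) \<Longrightarrow> \<Gamma> \<turnstile> Snd s \<approx> Snd t"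
  using eq_cong[of \<Gamma> s t "T \<times>\<^sub>t U" "Snd (Bound 0)" U] by (simp add: typed_iff)

lemma less_frac_unfold:
  assumes a: "typed [] a N" and c: "typed [] c N" and a': "typed [] a' N" and c': "typed [] c' N"
  shows "\<Gamma> \<turnstile> less_rat \<cdot> frac a c \<cdot> frac a' c' \<approx>
    Exists N (a' \<^bold>* Succ c \<approx> a \<^bold>* Succ c' \<^bold>+ Succ (Bound 0))"
proof -
  note [simp] = closedD[OF a] closedD[OF a'] closedD[OF c] closedD[OF c']
  define num den neg where "num p = Fst p" and "den p = Succ (Snd (Snd p))" and "neg p = Fst (Snd p)" for p
  note defs = num_def den_def neg_def
  let ?p = "frac a c" and ?q = "frac a' c'"
  have frac: "\<Gamma> \<turnstile> num (frac x z) \<approx> x" "\<Gamma> \<turnstile> neg (frac x z) \<approx> Zero" "\<Gamma> \<turnstile> den (frac x z) \<approx> Succ z"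
    "typed [] (num (frac x z)) N" "typed [] (neg (frac x z)) N" "typed [] (den (frac x z)) N"
    if x: "typed [] x N" and z: "typed [] z N" for x z
  proof -
    note [simp] = closedD[OF x] closedD[OF z]
    have snd: "\<Gamma> \<turnstile> Snd (frac x z) \<approx> Pair Zero z"
      by (rule snd_pair[where T = N and U = "N \<times>\<^sub>t N"]) (simp_all add: typed_iff)
    show "typed [] (num (frac x z)) N" "typed [] (neg (frac x z)) N" "typed [] (den (frac x z)) N"
      using x z by (simp_all add: defs typed_iff)
    show "\<Gamma> \<turnstile> num (frac x z) \<approx> x"
      unfolding defs by (rule fst_pair[where T = N and U = "N \<times>\<^sub>t N"]) (simp_all add: typed_iff)
    show "\<Gamma> \<turnstile> neg (frac x z) \<approx> Zero"
      unfolding defs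
      by (rule eq_trans[OF eq_Fst[OF snd, of N N] fst_pair[of Zero N z N]]) (simp_all add: typed_iff)
    show "\<Gamma> \<turnstile> den (frac x z) \<approx> Succ z"
      unfolding defs
      by (rule eq_Succ[OF eq_trans[OF eq_Snd[OF snd, of N N] snd_pair[of Zero N z N]]])
        (simp_all add: typed_iff)
  qed
  have side: "\<Gamma> \<turnstile> num (frac x z) \<^bold>* den (frac x' z') \<^bold>+ neg (frac x' z') \<^bold>* den (frac x z) \<approx> x \<^bold>* Succ z'"
    if x: "typed [] x N" and z: "typed [] z N" and x': "typed [] x' N" and z': "typed [] z' N" for x z x' z'
  proof -
    have "\<Gamma> \<turnstile> num (frac x z) \<^bold>* den (frac x' z') \<^bold>+ neg (frac x' z') \<^bold>* den (frac x z)
        \<approx> x \<^bold>* Succ z' \<^bold>+ Zero \<^bold>* Succ z"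
      by (intro eq_plus eq_times frac typed_arith that)
    also have "\<Gamma> \<turnstile> x \<^bold>* Succ z' \<^bold>+ Zero \<^bold>* Succ z \<approx> x \<^bold>* Succ z'"
      by (rule cls_eq) (simp_all add: cls_simps typed_arith that)
    finally show ?thesis .
  qed
  let ?l = "num ?p \<^bold>* den ?q \<^bold>+ neg ?q \<^bold>* den ?p" and ?r = "num ?q \<^bold>* den ?p \<^bold>+ neg ?p \<^bold>* den ?q"
  have "\<Gamma> \<turnstile> less_rat \<cdot> ?p \<cdot> ?q \<approx> less_nat \<cdot> ?l \<cdot> ?r"
    using beta2[of Q Q "less_nat \<cdot> (num (Bound 1) \<^bold>* den (Bound 0) \<^bold>+ neg (Bound 0) \<^bold>* den (Bound 1))
      \<cdot> (num (Bound 0) \<^bold>* den (Bound 1) \<^bold>+ neg (Bound 1) \<^bold>* den (Bound 0))" Om ?p ?q \<Gamma>] assms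
    by (simp add: less_rat_def binder_defs Let_def typed_iff defs)
  also have "\<Gamma> \<turnstile> less_nat \<cdot> ?l \<cdot> ?r \<approx> less_nat \<cdot> (a \<^bold>* Succ c') \<cdot> (a' \<^bold>* Succ c)"
    by (intro eq_less_nat side typed_arith frac assms)
  also have "\<Gamma> \<turnstile> less_nat \<cdot> (a \<^bold>* Succ c') \<cdot> (a' \<^bold>* Succ c) \<approx>
      Exists N (a' \<^bold>* Succ c \<approx> a \<^bold>* Succ c' \<^bold>+ Succ (Bound 0))"
    by (intro less_nat_unfold typed_arith assms)
  finally show ?thesis .
qed

lemma less_frac_intro:
  assumes "\<Gamma> \<turnstile> a' \<^bold>* Succ c \<approx> a \<^bold>* Succ c' \<^bold>+ Succ k" and k: "typed [] k N"
    and a: "typed [] a N" and c: "typed [] c N" and a': "typed [] a' N" and c': "typed [] c' N"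
  shows "\<Gamma> \<turnstile> less_rat \<cdot> frac a c \<cdot> frac a' c'"
proof -
  note [simp] = closedD[OF a] closedD[OF a'] closedD[OF c] closedD[OF c']
  have "\<Gamma> \<turnstile> Exists N (a' \<^bold>* Succ c \<approx> a \<^bold>* Succ c' \<^bold>+ Succ (Bound 0))"
    by (rule existsI[OF _ k]) (use assms in \<open>simp_all add: typed_iff\<close>)
  then show ?thesis
    using eq_iff[OF less_frac_unfold[OF a c a' c']] by (simp add: typed_iff)
qed

lemma less_frac_elim:
  assumes less: "\<Gamma> \<turnstile> less_rat \<cdot> frac a c \<cdot> frac a' c'"
    and a: "typed [] a N" and c: "typed [] c N" and a': "typed [] a' N" and c': "typed [] c' N"
    and "\<And>\<Delta> k. \<Gamma> \<sqsubseteq> \<Delta> \<Longrightarrow> typed [] k N \<Longrightarrow> \<Delta> \<turnstile> a' \<^bold>* Succ c \<approx> a \<^bold>* Succ c' \<^bold>+ Succ k \<Longrightarrow> \<Delta> \<turnstile> \<psi>"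
  shows "\<Gamma> \<turnstile> \<psi>"
proof -
  note [simp] = closedD[OF a] closedD[OF a'] closedD[OF c] closedD[OF c']
  have "\<Gamma> \<turnstile> Exists N (a' \<^bold>* Succ c \<approx> a \<^bold>* Succ c' \<^bold>+ Succ (Bound 0))"
    using less eq_iff[OF less_frac_unfold[OF a c a' c']] by (simp add: typed_iff)
  then show ?thesis
    by (rule exists_elim) (use assms(6) in simp)
qed

section \<open>Suprema\<close>

definition upper_bound :: "tm \<Rightarrow> tm \<Rightarrow> tm" where
  "upper_bound A p = Forall Q (A \<cdot> Bound 0 \<^bold>\<longrightarrow> \<^bold>\<not> (less_rat \<cdot> p \<cdot> Bound 0))"

text \<open>
  The upper set consists of the numbers above some upper bound of \<open>A\<close>, and the lower set is then forced
  by the first cut condition.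
\<close>

definition sup_upper :: "tm \<Rightarrow> tm" where
  "sup_upper A = Lam Q (Exists Q (less_rat \<cdot> Bound 0 \<cdot> Bound 1 \<^bold>\<and>
     Forall Q (A \<cdot> Bound 0 \<^bold>\<longrightarrow> \<^bold>\<not> (less_rat \<cdot> Bound 1 \<cdot> Bound 0))))"

definition sup_lower :: "tm \<Rightarrow> tm" where
  "sup_lower A = Lam Q (Exists Q (less_rat \<cdot> Bound 1 \<cdot> Bound 0 \<^bold>\<and> \<^bold>\<not> (sup_upper A \<cdot> Bound 0)))"

definition supremum :: "tm \<Rightarrow> tm" where
  "supremum A = Pair (sup_lower A) (sup_upper A)"

lemma typed_supremum:
  assumes A: "typed [] A (Pow Q)"
  shows "typed [] (sup_upper A) (Pow Q)" "typed [] (sup_lower A) (Pow Q)" "typed [] (supremum A) Cut"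
proof -
  note [simp] = closedD[OF A]
  show upper: "typed [] (sup_upper A) (Pow Q)"
    by (simp add: sup_upper_def typed_iff)
  note [simp] = closedD[OF upper]
  show lower: "typed [] (sup_lower A) (Pow Q)"
    by (simp add: sup_lower_def typed_iff)
  show "typed [] (supremum A) Cut"
    using upper lower by (simp add: supremum_def typed_iff)
qed

lemma upper_boundI:
  assumes A: "typed [] A (Pow Q)" and p: "typed [] p Q"
    and step: "\<And>\<Delta> a. \<Gamma> \<sqsubseteq> \<Delta> \<Longrightarrow> typed [] a Q \<Longrightarrow> \<Delta> \<turnstile> A \<cdot> a \<Longrightarrow> \<Delta> \<turnstile> less_rat \<cdot> p \<cdot> a \<Longrightarrow> \<Delta> \<turnstile> Falsum"
  shows "\<Gamma> \<turnstile> upper_bound A p"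
  unfolding upper_bound_def
proof (rule forall_intro)
  note [simp] = closedD[OF A] closedD[OF p]
  show "typed [Q] (A \<cdot> Bound 0 \<^bold>\<longrightarrow> \<^bold>\<not> (less_rat \<cdot> p \<cdot> Bound 0)) Om"
    by (simp add: typed_iff)
  fix a assume a: "typed [] a Q"
  note [simp] = closedD[OF a]
  have "\<Gamma> \<turnstile> A \<cdot> a \<^bold>\<longrightarrow> less_rat \<cdot> p \<cdot> a \<^bold>\<longrightarrow> Falsum"
  proof (rule impl_intro)
    fix \<Delta> assume \<Delta>: "\<Gamma> \<sqsubseteq> \<Delta>" and Aa: "\<Delta> \<turnstile> A \<cdot> a"
    show "\<Delta> \<turnstile> less_rat \<cdot> p \<cdot> a \<^bold>\<longrightarrow> Falsum"
    proof (rule impl_intro)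
      fix \<Theta> assume \<Theta>: "\<Delta> \<sqsubseteq> \<Theta>" and "\<Theta> \<turnstile> less_rat \<cdot> p \<cdot> a"
      then show "\<Theta> \<turnstile> Falsum"
        using step[OF weaker_trans[OF \<Delta> \<Theta>] a weakening[OF Aa \<Theta>]] by simp
    qed (simp add: typed_iff)
  qed (simp add: typed_iff)
  then show "\<Gamma> \<turnstile> (A \<cdot> Bound 0 \<^bold>\<longrightarrow> \<^bold>\<not> (less_rat \<cdot> p \<cdot> Bound 0))\<lbrakk>a\<rbrakk>"
    by simp
qed

lemma upper_boundD:
  assumes A: "typed [] A (Pow Q)" and p: "typed [] p Q" and a: "typed [] a Q"
    and ub: "\<Gamma> \<turnstile> upper_bound A p" and Aa: "\<Gamma> \<turnstile> A \<cdot> a" and less: "\<Gamma> \<turnstile> less_rat \<cdot> p \<cdot> a"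
  shows "\<Gamma> \<turnstile> Falsum"
proof -
  note [simp] = closedD[OF A] closedD[OF p]
  have "\<Gamma> \<turnstile> A \<cdot> a \<^bold>\<longrightarrow> less_rat \<cdot> p \<cdot> a \<^bold>\<longrightarrow> Falsum"
    using forallE[OF ub[unfolded upper_bound_def] a] by simp
  then show ?thesis
    by (rule implE[OF implE[OF _ Aa] less])
qed

lemma Fst_App:
  assumes s: "typed [] s (T \<rightarrow>\<^sub>t Om)" and t: "typed [] t U" and a: "typed [] a T"
  shows "\<Gamma> \<turnstile> Fst (Pair s t) \<cdot> a \<longleftrightarrow> \<Gamma> \<turnstile> s \<cdot> a"
  by (rule eq_iff[OF eq_App[OF fst_pair[OF s t] refl[OF a] _ a]])
    (use s t a in \<open>simp_all add: typed_iff\<close>)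

lemma Snd_App:
  assumes s: "typed [] s U" and t: "typed [] t (T \<rightarrow>\<^sub>t Om)" and a: "typed [] a T"
  shows "\<Gamma> \<turnstile> Snd (Pair s t) \<cdot> a \<longleftrightarrow> \<Gamma> \<turnstile> t \<cdot> a"
  by (rule eq_iff[OF eq_App[OF snd_pair[OF s t] refl[OF a] _ a]])
    (use s t a in \<open>simp_all add: typed_iff\<close>)

lemma Snd_supremum:
  assumes A: "typed [] A (Pow Q)" and q: "typed [] q Q"
  shows "\<Gamma> \<turnstile> Snd (supremum A) \<cdot> q \<longleftrightarrow> \<Gamma> \<turnstile> Exists Q (less_rat \<cdot> Bound 0 \<cdot> q \<^bold>\<and>
     Forall Q (A \<cdot> Bound 0 \<^bold>\<longrightarrow> \<^bold>\<not> (less_rat \<cdot> Bound 1 \<cdot> Bound 0)))"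
proof -
  note [simp] = closedD[OF A] closedD[OF q]
  show ?thesis
    unfolding supremum_def Snd_App[OF typed_supremum(2,1)[OF A] q]
    unfolding sup_upper_def
    by (subst beta_iff[OF _ q]) (simp_all add: typed_iff)
qed

lemma Fst_supremum:
  assumes A: "typed [] A (Pow Q)" and p: "typed [] p Q"
  shows "\<Gamma> \<turnstile> Fst (supremum A) \<cdot> p \<longleftrightarrow>
    \<Gamma> \<turnstile> Exists Q (less_rat \<cdot> p \<cdot> Bound 0 \<^bold>\<and> \<^bold>\<not> (sup_upper A \<cdot> Bound 0))"
proof -
  note [simp] = closedD[OF A] closedD[OF p] typed_supremum(1)[OF A, THEN closedD]
  show ?thesis
    unfolding supremum_def Fst_App[OF typed_supremum(2,1)[OF A] p]
    unfolding sup_lower_def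
    by (subst beta_iff[OF _ p]) (simp_all add: typed_iff)
qed

lemma supremum_upperI:
  assumes A: "typed [] A (Pow Q)" and p: "typed [] p Q" and q: "typed [] q Q"
    and less: "\<Gamma> \<turnstile> less_rat \<cdot> p \<cdot> q" and ub: "\<Gamma> \<turnstile> upper_bound A p"
  shows "\<Gamma> \<turnstile> Snd (supremum A) \<cdot> q"
  unfolding Snd_supremum[OF A q]
proof (rule existsI[OF _ p])
  note [simp] = closedD[OF A] closedD[OF p] closedD[OF q]
  show "typed [Q] (less_rat \<cdot> Bound 0 \<cdot> q \<^bold>\<and>
     Forall Q (A \<cdot> Bound 0 \<^bold>\<longrightarrow> \<^bold>\<not> (less_rat \<cdot> Bound 1 \<cdot> Bound 0))) Om"
    by (simp add: typed_iff)
  show "\<Gamma> \<turnstile> (less_rat \<cdot> Bound 0 \<cdot> q \<^bold>\<and>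
     Forall Q (A \<cdot> Bound 0 \<^bold>\<longrightarrow> \<^bold>\<not> (less_rat \<cdot> Bound 1 \<cdot> Bound 0)))\<lbrakk>p\<rbrakk>"
    using conjI[OF less ub] by (simp add: upper_bound_def)
qed

lemma supremum_upperE:
  assumes A: "typed [] A (Pow Q)" and q: "typed [] q Q" and upper: "\<Gamma> \<turnstile> Snd (supremum A) \<cdot> q"
    and step: "\<And>\<Delta> p. \<Gamma> \<sqsubseteq> \<Delta> \<Longrightarrow> typed [] p Q \<Longrightarrow> \<Delta> \<turnstile> less_rat \<cdot> p \<cdot> q \<Longrightarrow> \<Delta> \<turnstile> upper_bound A p \<Longrightarrow> \<Delta> \<turnstile> \<psi>"
  shows "\<Gamma> \<turnstile> \<psi>"
proof (rule exists_elim[OF upper[unfolded Snd_supremum[OF A q]]])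
  fix \<Delta> p assume \<Delta>: "\<Gamma> \<sqsubseteq> \<Delta>" and p: "typed [] p Q"
    and *: "\<Delta> \<turnstile> (less_rat \<cdot> Bound 0 \<cdot> q \<^bold>\<and>
      Forall Q (A \<cdot> Bound 0 \<^bold>\<longrightarrow> \<^bold>\<not> (less_rat \<cdot> Bound 1 \<cdot> Bound 0)))\<lbrakk>p\<rbrakk>"
  note [simp] = closedD[OF A] closedD[OF p] closedD[OF q]
  have "\<Delta> \<turnstile> less_rat \<cdot> p \<cdot> q \<^bold>\<and> upper_bound A p"
    using * by (simp add: upper_bound_def)
  then show "\<Delta> \<turnstile> \<psi>"
    by (intro step[OF \<Delta> p]) (erule conjE1 conjE2)+
qed

lemma supremum_lowerI:
  assumes A: "typed [] A (Pow Q)" and p: "typed [] p Q" and q: "typed [] q Q"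
    and less: "\<Gamma> \<turnstile> less_rat \<cdot> p \<cdot> q"
    and not_upper: "\<And>\<Delta>. \<Gamma> \<sqsubseteq> \<Delta> \<Longrightarrow> \<Delta> \<turnstile> Snd (supremum A) \<cdot> q \<Longrightarrow> \<Delta> \<turnstile> Falsum"
  shows "\<Gamma> \<turnstile> Fst (supremum A) \<cdot> p"
  unfolding Fst_supremum[OF A p]
proof (rule existsI[OF _ q])
  note [simp] = closedD[OF A] closedD[OF p] closedD[OF q] typed_supremum(1)[OF A, THEN closedD]
  show "typed [Q] (less_rat \<cdot> p \<cdot> Bound 0 \<^bold>\<and> \<^bold>\<not> (sup_upper A \<cdot> Bound 0)) Om"
    by (simp add: typed_iff)
  have "\<Gamma> \<turnstile> \<^bold>\<not> (sup_upper A \<cdot> q)"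
    using not_upper by (intro impl_intro)
      (simp_all add: typed_iff supremum_def Snd_App[OF typed_supremum(2,1)[OF A] q])
  with less show "\<Gamma> \<turnstile> (less_rat \<cdot> p \<cdot> Bound 0 \<^bold>\<and> \<^bold>\<not> (sup_upper A \<cdot> Bound 0))\<lbrakk>q\<rbrakk>"
    by (simp add: conjI)
qed

lemma supremum_lowerE:
  assumes A: "typed [] A (Pow Q)" and p: "typed [] p Q" and lower: "\<Gamma> \<turnstile> Fst (supremum A) \<cdot> p"
    and step: "\<And>\<Delta> q. \<Gamma> \<sqsubseteq> \<Delta> \<Longrightarrow> typed [] q Q \<Longrightarrow> \<Delta> \<turnstile> less_rat \<cdot> p \<cdot> q \<Longrightarrow>
      (\<And>\<Theta>. \<Delta> \<sqsubseteq> \<Theta> \<Longrightarrow> \<Theta> \<turnstile> Snd (supremum A) \<cdot> q \<Longrightarrow> \<Theta> \<turnstile> Falsum) \<Longrightarrow> \<Delta> \<turnstile> \<psi>"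
  shows "\<Gamma> \<turnstile> \<psi>"
proof (rule exists_elim[OF lower[unfolded Fst_supremum[OF A p]]])
  fix \<Delta> q assume \<Delta>: "\<Gamma> \<sqsubseteq> \<Delta>" and q: "typed [] q Q"
    and *: "\<Delta> \<turnstile> (less_rat \<cdot> p \<cdot> Bound 0 \<^bold>\<and> \<^bold>\<not> (sup_upper A \<cdot> Bound 0))\<lbrakk>q\<rbrakk>"
  note [simp] = closedD[OF A] closedD[OF p] closedD[OF q] typed_supremum(1)[OF A, THEN closedD]
  have conj: "\<Delta> \<turnstile> less_rat \<cdot> p \<cdot> q \<^bold>\<and> \<^bold>\<not> (sup_upper A \<cdot> q)"
    using * by simp
  show "\<Delta> \<turnstile> \<psi>"
  proof (rule step[OF \<Delta> q conjE1[OF conj]])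
    fix \<Theta> assume \<Theta>: "\<Delta> \<sqsubseteq> \<Theta>" and "\<Theta> \<turnstile> Snd (supremum A) \<cdot> q"
    then have "\<Theta> \<turnstile> sup_upper A \<cdot> q"
      by (simp add: supremum_def Snd_App[OF typed_supremum(2,1)[OF A] q])
    then show "\<Theta> \<turnstile> Falsum"
      by (rule implE[OF weakening[OF conjE2[OF conj] \<Theta>]])
  qed
qed

text \<open>
  The element \<open>a\<close> is itself a witness: a number \<open>s < a\<close> cannot be an upper bound, so \<open>a\<close> is not
  in the upper set.
\<close>

lemma below_element_lower:
  assumes A: "typed [] A (Pow Q)" and p: "typed [] p Q" and a: "typed [] a Q"
    and Aa: "\<Gamma> \<turnstile> A \<cdot> a" and less: "\<Gamma> \<turnstile> less_rat \<cdot> p \<cdot> a"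
  shows "\<Gamma> \<turnstile> Fst (supremum A) \<cdot> p"
proof (rule supremum_lowerI[OF A p a less])
  fix \<Delta> assume \<Delta>: "\<Gamma> \<sqsubseteq> \<Delta>" and upper: "\<Delta> \<turnstile> Snd (supremum A) \<cdot> a"
  show "\<Delta> \<turnstile> Falsum"
  proof (rule supremum_upperE[OF A a upper])
    fix \<Theta> s assume \<Theta>: "\<Delta> \<sqsubseteq> \<Theta>" and s: "typed [] s Q"
      and "\<Theta> \<turnstile> less_rat \<cdot> s \<cdot> a" and "\<Theta> \<turnstile> upper_bound A s"
    then show "\<Theta> \<turnstile> Falsum"
      using upper_boundD[OF A s a] weakening[OF weakening[OF Aa \<Delta>] \<Theta>] by blast
  qed
qed

text \<open>
  If \<open>p < q\<close> and \<open>p\<close> is an upper bound, then \<open>q\<close> is in the upper set; so no such \<open>q\<close> witnesses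
  that \<open>p\<close> is in the lower set.
\<close>

lemma upper_bound_not_lower:
  assumes A: "typed [] A (Pow Q)" and p: "typed [] p Q"
    and lower: "\<Gamma> \<turnstile> Fst (supremum A) \<cdot> p" and ub: "\<Gamma> \<turnstile> upper_bound A p"
  shows "\<Gamma> \<turnstile> Falsum"
proof (rule supremum_lowerE[OF A p lower])
  fix \<Delta> q assume \<Delta>: "\<Gamma> \<sqsubseteq> \<Delta>" and q: "typed [] q Q" and less: "\<Delta> \<turnstile> less_rat \<cdot> p \<cdot> q"
    and not_upper: "\<And>\<Theta>. \<Delta> \<sqsubseteq> \<Theta> \<Longrightarrow> \<Theta> \<turnstile> Snd (supremum A) \<cdot> q \<Longrightarrow> \<Theta> \<turnstile> Falsum"
  show "\<Delta> \<turnstile> Falsum"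
    by (rule not_upper[OF weaker_refl supremum_upperI[OF A p q less weakening[OF ub \<Delta>]]])
qed

lemma macneille_realI:
  assumes x: "typed [] x Cut" and p0: "typed [] p0 Q" and q0: "typed [] q0 Q"
    and inh: "\<Gamma> \<turnstile> Fst x \<cdot> p0" "\<Gamma> \<turnstile> Snd x \<cdot> q0"
    and L: "\<And>p. typed [] p Q \<Longrightarrow> \<Gamma> \<turnstile> Fst x \<cdot> p \<^bold>\<longleftrightarrow> Exists Q (less_rat \<cdot> p \<cdot> Bound 0 \<^bold>\<and> \<^bold>\<not> (Snd x \<cdot> Bound 0))"
    and U: "\<And>q. typed [] q Q \<Longrightarrow> \<Gamma> \<turnstile> Snd x \<cdot> q \<^bold>\<longleftrightarrow> Exists Q (less_rat \<cdot> Bound 0 \<cdot> q \<^bold>\<and> \<^bold>\<not> (Fst x \<cdot> Bound 0))"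
  shows "\<Gamma> \<turnstile> macneille_real \<cdot> x"
proof -
  note [simp] = closedD[OF x]
  have ex: "\<Gamma> \<turnstile> Exists Q (Fst x \<cdot> Bound 0)" "\<Gamma> \<turnstile> Exists Q (Snd x \<cdot> Bound 0)"
    by (rule existsI[OF _ p0], simp_all add: typed_iff inh)
      (rule existsI[OF _ q0], simp_all add: typed_iff inh)
  have all: "\<Gamma> \<turnstile> Forall Q (Fst x \<cdot> Bound 0 \<^bold>\<longleftrightarrow> Exists Q (less_rat \<cdot> Bound 1 \<cdot> Bound 0 \<^bold>\<and> \<^bold>\<not> (Snd x \<cdot> Bound 0)))"
    "\<Gamma> \<turnstile> Forall Q (Snd x \<cdot> Bound 0 \<^bold>\<longleftrightarrow> Exists Q (less_rat \<cdot> Bound 0 \<cdot> Bound 1 \<^bold>\<and> \<^bold>\<not> (Fst x \<cdot> Bound 0)))"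
    by (rule forall_intro; simp add: typed_iff L U)+
  let ?\<phi> = "Exists Q (Fst (Bound 1) \<cdot> Bound 0) \<^bold>\<and> Exists Q (Snd (Bound 1) \<cdot> Bound 0) \<^bold>\<and>
    Forall Q (Fst (Bound 1) \<cdot> Bound 0 \<^bold>\<longleftrightarrow> Exists Q (less_rat \<cdot> Bound 1 \<cdot> Bound 0 \<^bold>\<and> \<^bold>\<not> (Snd (Bound 2) \<cdot> Bound 0))) \<^bold>\<and>
    Forall Q (Snd (Bound 1) \<cdot> Bound 0 \<^bold>\<longleftrightarrow> Exists Q (less_rat \<cdot> Bound 0 \<cdot> Bound 1 \<^bold>\<and> \<^bold>\<not> (Fst (Bound 2) \<cdot> Bound 0)))"
  have "macneille_real = Lam Cut ?\<phi>"
    by (simp add: macneille_real_def binder_defs Let_def numeral_2_eq_2)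
  moreover have "\<Gamma> \<turnstile> Lam Cut ?\<phi> \<cdot> x"
    by (subst beta_iff[OF _ x]) (use ex all in \<open>simp_all add: typed_iff conjI numeral_2_eq_2\<close>)
  ultimately show ?thesis by simp
qed

text \<open>
  Order completeness. The first cut condition is the definition of the lower set. For the second one,
  an upper bound \<open>p < q\<close> is not in the lower set by \<open>upper_bound_not_lower\<close>; conversely, if
  \<open>p < q\<close> is not in the lower set, then no element of \<open>A\<close> lies above \<open>p\<close> by
  \<open>below_element_lower\<close>, so \<open>p\<close> is an upper bound. The numbers \<open>p0\<close> and
  \<open>q0\<close> inhabit the two halves.
\<close>

lemma macneille_supremum:
  assumes A: "typed [] A (Pow Q)" and p0: "typed [] p0 Q" and a0: "typed [] a0 Q"
    and b0: "typed [] b0 Q" and q0: "typed [] q0 Q"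
    and nonempty: "\<Gamma> \<turnstile> A \<cdot> a0" and below: "\<Gamma> \<turnstile> less_rat \<cdot> p0 \<cdot> a0"
    and bounded: "\<Gamma> \<turnstile> upper_bound A b0" and above: "\<Gamma> \<turnstile> less_rat \<cdot> b0 \<cdot> q0"
  shows "\<Gamma> \<turnstile> macneille_real \<cdot> supremum A"
proof (rule macneille_realI[OF _ p0 q0])
  note typed_supremum[OF A, THEN closedD, simp]
  show "typed [] (supremum A) Cut"
    by (rule typed_supremum[OF A])
  show "\<Gamma> \<turnstile> Fst (supremum A) \<cdot> p0"
    by (rule below_element_lower[OF A p0 a0 nonempty below])
  show "\<Gamma> \<turnstile> Snd (supremum A) \<cdot> q0"
    by (rule supremum_upperI[OF A b0 q0 above bounded])
next
  note typed_supremum[OF A, THEN closedD, simp]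
  fix p assume p: "typed [] p Q"
  note [simp] = closedD[OF p]
  let ?\<phi> = "less_rat \<cdot> p \<cdot> Bound 0 \<^bold>\<and> \<^bold>\<not> (Snd (supremum A) \<cdot> Bound 0)"
  have \<phi>: "typed [Q] ?\<phi> Om"
    by (simp add: typed_iff)
  have 1: "\<Delta> \<turnstile> Exists Q ?\<phi>" if lower: "\<Delta> \<turnstile> Fst (supremum A) \<cdot> p" for \<Delta>
  proof (rule supremum_lowerE[OF A p lower])
    fix \<Delta>' q assume q: "typed [] q Q" and less: "\<Delta>' \<turnstile> less_rat \<cdot> p \<cdot> q"
      and not_upper: "\<And>\<Theta>. \<Delta>' \<sqsubseteq> \<Theta> \<Longrightarrow> \<Theta> \<turnstile> Snd (supremum A) \<cdot> q \<Longrightarrow> \<Theta> \<turnstile> Falsum"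
    note [simp] = closedD[OF q]
    have "\<Delta>' \<turnstile> \<^bold>\<not> (Snd (supremum A) \<cdot> q)"
      by (rule impl_intro[OF _ not_upper]) (simp_all add: typed_iff)
    then show "\<Delta>' \<turnstile> Exists Q ?\<phi>"
      by (intro existsI[OF \<phi> q]) (simp add: conjI less)
  qed
  have 2: "\<Delta> \<turnstile> Fst (supremum A) \<cdot> p" if ex: "\<Delta> \<turnstile> Exists Q ?\<phi>" for \<Delta>
  proof (rule exists_elim[OF ex])
    fix \<Delta>' q assume q: "typed [] q Q" and "\<Delta>' \<turnstile> ?\<phi>\<lbrakk>q\<rbrakk>"
    then have conj: "\<Delta>' \<turnstile> less_rat \<cdot> p \<cdot> q \<^bold>\<and> \<^bold>\<not> (Snd (supremum A) \<cdot> q)"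
      by simp
    show "\<Delta>' \<turnstile> Fst (supremum A) \<cdot> p"
      by (rule supremum_lowerI[OF A p q conjE1[OF conj]]) (rule implE[OF weakening[OF conjE2[OF conj]]])
  qed
  show "\<Gamma> \<turnstile> Fst (supremum A) \<cdot> p \<^bold>\<longleftrightarrow> Exists Q ?\<phi>"
    by (rule iff_intro[OF _ _ 1 2]) (simp_all add: typed_iff)
next
  note typed_supremum[OF A, THEN closedD, simp]
  fix q assume q: "typed [] q Q"
  note [simp] = closedD[OF q]
  let ?\<phi> = "less_rat \<cdot> Bound 0 \<cdot> q \<^bold>\<and> \<^bold>\<not> (Fst (supremum A) \<cdot> Bound 0)"
  have \<phi>: "typed [Q] ?\<phi> Om"
    by (simp add: typed_iff)
  have 1: "\<Delta> \<turnstile> Exists Q ?\<phi>" if upper: "\<Delta> \<turnstile> Snd (supremum A) \<cdot> q" for \<Delta>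
  proof (rule supremum_upperE[OF A q upper])
    fix \<Delta>' p assume p: "typed [] p Q" and less: "\<Delta>' \<turnstile> less_rat \<cdot> p \<cdot> q"
      and ub: "\<Delta>' \<turnstile> upper_bound A p"
    note [simp] = closedD[OF p]
    have "\<Delta>' \<turnstile> \<^bold>\<not> (Fst (supremum A) \<cdot> p)"
      by (rule impl_intro[OF _ upper_bound_not_lower[OF A p _ weakening[OF ub]]]) (simp_all add: typed_iff)
    then show "\<Delta>' \<turnstile> Exists Q ?\<phi>"
      by (intro existsI[OF \<phi> p]) (simp add: conjI less)
  qed
  have 2: "\<Delta> \<turnstile> Snd (supremum A) \<cdot> q" if ex: "\<Delta> \<turnstile> Exists Q ?\<phi>" for \<Delta>
  proof (rule exists_elim[OF ex])
    fix \<Delta>' p assume p: "typed [] p Q" and "\<Delta>' \<turnstile> ?\<phi>\<lbrakk>p\<rbrakk>"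
    then have conj: "\<Delta>' \<turnstile> less_rat \<cdot> p \<cdot> q \<^bold>\<and> \<^bold>\<not> (Fst (supremum A) \<cdot> p)"
      by simp
    have "\<Delta>' \<turnstile> upper_bound A p"
    proof (rule upper_boundI[OF A p])
      fix \<Theta> a assume \<Theta>: "\<Delta>' \<sqsubseteq> \<Theta>" and a: "typed [] a Q" and "\<Theta> \<turnstile> A \<cdot> a" "\<Theta> \<turnstile> less_rat \<cdot> p \<cdot> a"
      then have "\<Theta> \<turnstile> Fst (supremum A) \<cdot> p"
        by (intro below_element_lower[OF A p a])
      then show "\<Theta> \<turnstile> Falsum"
        by (rule implE[OF weakening[OF conjE2[OF conj] \<Theta>]])
    qed
    then show "\<Delta>' \<turnstile> Snd (supremum A) \<cdot> q"
      by (rule supremum_upperI[OF A p q conjE1[OF conj]])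
  qed
  show "\<Gamma> \<turnstile> Snd (supremum A) \<cdot> q \<^bold>\<longleftrightarrow> Exists Q ?\<phi>"
    by (rule iff_intro[OF _ _ 1 2]) (simp_all add: typed_iff)
qed

section \<open>Nested cells\<close>

definition triple :: "tm \<Rightarrow> tm" where
  "triple n = n \<^bold>+ n \<^bold>+ n"

text \<open>
  This is \<open>3 ^ n - 1\<close>, since a triple stores the predecessor of the denominator.
\<close>

definition den_pred :: "tm \<Rightarrow> tm" where
  "den_pred n = Rec Zero (Lam N (Lam N (Succ (Succ (triple (Bound 0)))))) n"

text \<open>
  The endpoints of the interval from \<open>a / 3 ^ n\<close> to \<open>(a + 1) / 3 ^ n\<close>.
\<close>

definition lo :: "tm \<Rightarrow> tm \<Rightarrow> tm" where
  "lo n a = frac a (den_pred n)"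

definition hi :: "tm \<Rightarrow> tm \<Rightarrow> tm" where
  "hi n a = frac (Succ a) (den_pred n)"

text \<open>
  The right endpoint of the left third of the interval belongs to the lower set of the \<open>n\<close>-th value
  of \<open>f\<close>. In this case the left third excludes that value; otherwise the right third does, because its
  left endpoint is strictly larger than the endpoint tested.
\<close>

definition goes_left :: "tm \<Rightarrow> tm \<Rightarrow> tm \<Rightarrow> tm" where
  "goes_left f n a = Fst (f \<cdot> n) \<cdot> hi (Succ n) (triple a)"

text \<open>
  The set of numerators \<open>a\<close> of the interval reached after \<open>n\<close> steps, starting from the interval
  from 1 to 2. It is a set because the test is not decidable, so that no function can return the
  numerator; \<open>cell_unique\<close> and \<open>cell_exists\<close> say that it has one element up to double negation. The
  interval starts at 1 so that a number below it has the form \<open>frac a c\<close>.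
\<close>

definition cell :: "tm \<Rightarrow> tm \<Rightarrow> tm" where
  "cell f n = Rec (Lam N (Bound 0 \<approx> Succ Zero))
     (Lam N (Lam (Pow N) (Lam N (Exists N (Bound 2 \<cdot> Bound 0 \<^bold>\<and>
       (goes_left f (Bound 3) (Bound 0) \<^bold>\<and> Bound 1 \<approx> triple (Bound 0) \<^bold>\<or>
        \<^bold>\<not> goes_left f (Bound 3) (Bound 0) \<^bold>\<and> Bound 1 \<approx> Succ (Succ (triple (Bound 0)))))))))
     n"

definition left_ends :: "tm \<Rightarrow> tm" where
  "left_ends f = Lam Q (Exists N (Exists N (cell f (Bound 1) \<cdot> Bound 0 \<^bold>\<and> Bound 2 \<approx> lo (Bound 1) (Bound 0))))"

lemma inst_defs [simp]:
  "inst k u (triple t) = triple (inst k u t)"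
  "inst k u (den_pred t) = den_pred (inst k u t)"
  "inst k u (lo t s) = lo (inst k u t) (inst k u s)"
  "inst k u (hi t s) = hi (inst k u t) (inst k u s)"
  "inst k u (goes_left f t s) = goes_left (inst k u f) (inst k u t) (inst k u s)"
  by (simp_all add: triple_def den_pred_def lo_def hi_def goes_left_def)

lemma type_of_defs [simp]:
  "type_of E t = Some N \<Longrightarrow> type_of E (triple t) = Some N"
  "type_of E t = Some N \<Longrightarrow> type_of E (den_pred t) = Some N"
  "type_of E t = Some N \<Longrightarrow> type_of E s = Some N \<Longrightarrow> type_of E (lo t s) = Some Q"
  "type_of E t = Some N \<Longrightarrow> type_of E s = Some N \<Longrightarrow> type_of E (hi t s) = Some Q"
  "type_of E f = Some (N \<rightarrow>\<^sub>t Cut) \<Longrightarrow> type_of E t = Some N \<Longrightarrow> type_of E s = Some N \<Longrightarrow>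
     type_of E (goes_left f t s) = Some Om"
  by (simp_all add: triple_def den_pred_def lo_def hi_def goes_left_def)

lemma typed_triple: "typed [] t N \<Longrightarrow> typed [] (triple t) N"
  and typed_den_pred: "typed [] t N \<Longrightarrow> typed [] (den_pred t) N"
  by (simp_all add: typed_iff)

lemmas typed_nat = typed_arith typed_triple typed_den_pred

lemma eq_triple: "\<Gamma> \<turnstile> s \<approx> t \<Longrightarrow> typed [] s N \<Longrightarrow> \<Gamma> \<turnstile> triple s \<approx> triple t"
  unfolding triple_def by (intro eq_plus typed_arith)

lemma cls_triple: "typed [] t N \<Longrightarrow> cls (triple t) = cls t + cls t + cls t"
  by (simp add: triple_def cls_simps typed_arith)

lemma den_pred_Succ:
  assumes n: "typed [] n N"
  shows "\<Gamma> \<turnstile> Succ (den_pred (Succ n)) \<approx> triple (Succ (den_pred n))"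
proof -
  note [simp] = closedD[OF n]
  let ?s = "Lam N (Lam N (Succ (Succ (triple (Bound 0)))))"
  have "\<Gamma> \<turnstile> den_pred (Succ n) \<approx> ?s \<cdot> n \<cdot> den_pred n"
    unfolding den_pred_def using n by (intro rec_succ[where T = N]) (auto simp: typed_iff)
  also have "\<Gamma> \<turnstile> ?s \<cdot> n \<cdot> den_pred n \<approx> Succ (Succ (triple (den_pred n)))"
    using beta2[of N N "Succ (Succ (triple (Bound 0)))" N n "den_pred n" \<Gamma>] n
    by (simp add: typed_iff)
  finally have "\<Gamma> \<turnstile> Succ (den_pred (Succ n)) \<approx> Succ (Succ (Succ (triple (den_pred n))))"
    by (intro eq_Succ typed_nat n)
  also have "\<Gamma> \<turnstile> Succ (Succ (Succ (triple (den_pred n)))) \<approx> triple (Succ (den_pred n))"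
    by (rule cls_eq) (simp_all add: cls_simps cls_triple typed_nat n algebra_simps)
  finally show ?thesis .
qed

text \<open>
  Passing from the interval \<open>b\<close> of stage \<open>m\<close> to one of its outer thirds keeps it inside the
  interval \<open>a\<close> of stage \<open>n\<close>. Denominators are cleared, and \<open>i\<close> is 0 for the left and 2 for the right
  third; its complement \<open>i'\<close> is what remains of the interval on the right.
\<close>

lemma nested_step:
  assumes n: "typed [] n N" and m: "typed [] m N" and a: "typed [] a N" and b: "typed [] b N"
    and c: "typed [] c N" and i: "typed [] i N" and i': "typed [] i' N" and two: "cls i + cls i' = 1 + 1"
    and c_eq: "\<Gamma> \<turnstile> c \<approx> triple b \<^bold>+ i"
    and lower: "\<Gamma> \<turnstile> leq_nat \<cdot> (a \<^bold>* Succ (den_pred m)) \<cdot> (b \<^bold>* Succ (den_pred n))"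
    and upper: "\<Gamma> \<turnstile> leq_nat \<cdot> (Succ b \<^bold>* Succ (den_pred n)) \<cdot> (Succ a \<^bold>* Succ (den_pred m))"
  shows "\<Gamma> \<turnstile> leq_nat \<cdot> (a \<^bold>* Succ (den_pred (Succ m))) \<cdot> (c \<^bold>* Succ (den_pred n))"
    and "\<Gamma> \<turnstile> leq_nat \<cdot> (Succ c \<^bold>* Succ (den_pred n)) \<cdot> (Succ a \<^bold>* Succ (den_pred (Succ m)))"
proof -
  note typs = typed_nat n m a b c i i'
  have sum2: "cls i * z + cls i' * z = z + z" for z
    by (metis two distrib_right mult_1_left)
  show "\<Gamma> \<turnstile> leq_nat \<cdot> (a \<^bold>* Succ (den_pred (Succ m))) \<cdot> (c \<^bold>* Succ (den_pred n))"
  proof (rule leq_natE[OF _ _ lower])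
    fix \<Delta> u assume \<Delta>: "\<Gamma> \<sqsubseteq> \<Delta>" and u: "typed [] u N"
      and eq: "\<Delta> \<turnstile> b \<^bold>* Succ (den_pred n) \<approx> a \<^bold>* Succ (den_pred m) \<^bold>+ u"
    have "\<Delta> \<turnstile> c \<^bold>* Succ (den_pred n) \<approx> (triple b \<^bold>+ i) \<^bold>* Succ (den_pred n)"
      by (intro eq_times weakening[OF c_eq \<Delta>] eq_refl typs)
    also have "\<Delta> \<turnstile> (triple b \<^bold>+ i) \<^bold>* Succ (den_pred n) \<approx> triple (b \<^bold>* Succ (den_pred n)) \<^bold>+ i \<^bold>* Succ (den_pred n)"
      by (rule cls_eq) (simp_all add: cls_simps cls_triple typs algebra_simps)
    also have "\<Delta> \<turnstile> triple (b \<^bold>* Succ (den_pred n)) \<^bold>+ i \<^bold>* Succ (den_pred n)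
        \<approx> triple (a \<^bold>* Succ (den_pred m) \<^bold>+ u) \<^bold>+ i \<^bold>* Succ (den_pred n)"
      by (intro eq_plus eq_triple eq eq_refl typs)
    also have "\<Delta> \<turnstile> triple (a \<^bold>* Succ (den_pred m) \<^bold>+ u) \<^bold>+ i \<^bold>* Succ (den_pred n)
        \<approx> a \<^bold>* triple (Succ (den_pred m)) \<^bold>+ (triple u \<^bold>+ i \<^bold>* Succ (den_pred n))"
      by (rule cls_eq) (simp_all add: cls_simps cls_triple typs u algebra_simps)
    also have "\<Delta> \<turnstile> a \<^bold>* triple (Succ (den_pred m)) \<^bold>+ (triple u \<^bold>+ i \<^bold>* Succ (den_pred n))
        \<approx> a \<^bold>* Succ (den_pred (Succ m)) \<^bold>+ (triple u \<^bold>+ i \<^bold>* Succ (den_pred n))"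
      by (rule eq_plus[OF eq_times[OF eq_refl eq_sym[OF den_pred_Succ]] eq_refl]) (intro typs u)+
    finally show "\<Delta> \<turnstile> leq_nat \<cdot> (a \<^bold>* Succ (den_pred (Succ m))) \<cdot> (c \<^bold>* Succ (den_pred n))"
      by (intro leq_natI[where k = "triple u \<^bold>+ i \<^bold>* Succ (den_pred n)"] typs u)
  qed (intro typs)+
  show "\<Gamma> \<turnstile> leq_nat \<cdot> (Succ c \<^bold>* Succ (den_pred n)) \<cdot> (Succ a \<^bold>* Succ (den_pred (Succ m)))"
  proof (rule leq_natE[OF _ _ upper])
    fix \<Delta> v assume \<Delta>: "\<Gamma> \<sqsubseteq> \<Delta>" and v: "typed [] v N"
      and eq: "\<Delta> \<turnstile> Succ a \<^bold>* Succ (den_pred m) \<approx> Succ b \<^bold>* Succ (den_pred n) \<^bold>+ v"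
    have "\<Delta> \<turnstile> Succ a \<^bold>* Succ (den_pred (Succ m)) \<approx> Succ a \<^bold>* triple (Succ (den_pred m))"
      by (rule eq_times[OF eq_refl den_pred_Succ]) (intro typs)+
    also have "\<Delta> \<turnstile> Succ a \<^bold>* triple (Succ (den_pred m)) \<approx> triple (Succ a \<^bold>* Succ (den_pred m))"
      by (rule cls_eq) (simp_all add: cls_simps cls_triple typs algebra_simps)
    also have "\<Delta> \<turnstile> triple (Succ a \<^bold>* Succ (den_pred m)) \<approx> triple (Succ b \<^bold>* Succ (den_pred n) \<^bold>+ v)"
      by (intro eq_triple eq typs)
    also have "\<Delta> \<turnstile> triple (Succ b \<^bold>* Succ (den_pred n) \<^bold>+ v)
        \<approx> Succ (triple b \<^bold>+ i) \<^bold>* Succ (den_pred n) \<^bold>+ (i' \<^bold>* Succ (den_pred n) \<^bold>+ triple v)"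
    proof (rule cls_eq)
      define x y z w where "x = cls b" and "y = cls (Succ (den_pred n))" and "z = cls v" and "w = x * y + x * y + x * y"
      have "cls (Succ (triple b \<^bold>+ i) \<^bold>* Succ (den_pred n) \<^bold>+ (i' \<^bold>* Succ (den_pred n) \<^bold>+ triple v))
          = w + y + (cls i * y + cls i' * y) + (z + z + z)"
        unfolding w_def x_def y_def z_def by (simp add: cls_simps cls_triple typs v algebra_simps)
      also have "\<dots> = cls (triple (Succ b \<^bold>* Succ (den_pred n) \<^bold>+ v))"
        unfolding sum2 unfolding w_def x_def y_def z_def
        by (simp add: cls_simps cls_triple typs v algebra_simps)
      finally show "cls (triple (Succ b \<^bold>* Succ (den_pred n) \<^bold>+ v))
        = cls (Succ (triple b \<^bold>+ i) \<^bold>* Succ (den_pred n) \<^bold>+ (i' \<^bold>* Succ (den_pred n) \<^bold>+ triple v))" ..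
    qed (intro typs v)+
    also have "\<Delta> \<turnstile> Succ (triple b \<^bold>+ i) \<^bold>* Succ (den_pred n) \<^bold>+ (i' \<^bold>* Succ (den_pred n) \<^bold>+ triple v)
        \<approx> Succ c \<^bold>* Succ (den_pred n) \<^bold>+ (i' \<^bold>* Succ (den_pred n) \<^bold>+ triple v)"
      by (rule eq_plus[OF eq_times[OF eq_Succ[OF eq_sym[OF weakening[OF c_eq \<Delta>]]] eq_refl] eq_refl])
        (intro typs v)+
    finally show "\<Delta> \<turnstile> leq_nat \<cdot> (Succ c \<^bold>* Succ (den_pred n)) \<cdot> (Succ a \<^bold>* Succ (den_pred (Succ m)))"
      by (intro leq_natI[where k = "i' \<^bold>* Succ (den_pred n) \<^bold>+ triple v"] typs v)
  qed (intro typs)+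
qed

context
  fixes f assumes f: "typed [] f (N \<rightarrow>\<^sub>t Cut)"
begin

lemmas f_closed [simp] = closedD[OF f]

lemma inst_cell [simp]: "inst k u (cell f t) = cell f (inst k u t)"
  by (simp add: cell_def)

lemma type_of_cell [simp]: "type_of E t = Some N \<Longrightarrow> type_of E (cell f t) = Some (Pow N)"
  by (simp add: cell_def numeral_2_eq_2 numeral_3_eq_3)

lemma cell_Zero:
  assumes a: "typed [] a N"
  shows "\<Gamma> \<turnstile> cell f Zero \<cdot> a \<longleftrightarrow> \<Gamma> \<turnstile> a \<approx> Succ Zero"
proof -
  note [simp] = closedD[OF a]
  have "\<Gamma> \<turnstile> cell f Zero \<approx> Lam N (Bound 0 \<approx> Succ Zero)"
    unfolding cell_def by (rule rec_zero[where T = "Pow N"]) (simp_all add: typed_iff numeral_2_eq_2 numeral_3_eq_3)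
  then have "\<Gamma> \<turnstile> cell f Zero \<cdot> a \<approx> Lam N (Bound 0 \<approx> Succ Zero) \<cdot> a"
    by (rule eq_App[OF _ eq_refl[OF a], where T = N and U = Om]) (simp_all add: typed_iff)
  then have "\<Gamma> \<turnstile> cell f Zero \<cdot> a \<longleftrightarrow> \<Gamma> \<turnstile> Lam N (Bound 0 \<approx> Succ Zero) \<cdot> a"
    by (rule eq_iff) (simp add: typed_iff)
  also have "\<dots> \<longleftrightarrow> \<Gamma> \<turnstile> a \<approx> Succ Zero"
    by (subst beta_iff[OF _ a]) (simp_all add: typed_iff)
  finally show ?thesis .
qed

lemma cell_Succ:
  assumes n: "typed [] n N" and b: "typed [] b N"
  shows "\<Gamma> \<turnstile> cell f (Succ n) \<cdot> b \<longleftrightarrow> \<Gamma> \<turnstile> Exists N (cell f n \<cdot> Bound 0 \<^bold>\<and>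
       (goes_left f n (Bound 0) \<^bold>\<and> b \<approx> triple (Bound 0) \<^bold>\<or>
        \<^bold>\<not> goes_left f n (Bound 0) \<^bold>\<and> b \<approx> Succ (Succ (triple (Bound 0)))))"
proof -
  note [simp] = closedD[OF n] closedD[OF b]
  let ?t = "Lam N (Exists N (Bound 2 \<cdot> Bound 0 \<^bold>\<and>
       (goes_left f (Bound 3) (Bound 0) \<^bold>\<and> Bound 1 \<approx> triple (Bound 0) \<^bold>\<or>
        \<^bold>\<not> goes_left f (Bound 3) (Bound 0) \<^bold>\<and> Bound 1 \<approx> Succ (Succ (triple (Bound 0))))))"
  let ?u = "Exists N (cell f n \<cdot> Bound 0 \<^bold>\<and>
       (goes_left f n (Bound 0) \<^bold>\<and> Bound 1 \<approx> triple (Bound 0) \<^bold>\<or>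
        \<^bold>\<not> goes_left f n (Bound 0) \<^bold>\<and> Bound 1 \<approx> Succ (Succ (triple (Bound 0)))))"
  have "\<Gamma> \<turnstile> cell f (Succ n) \<approx> Lam N (Lam (Pow N) ?t) \<cdot> n \<cdot> cell f n"
    unfolding cell_def
    by (rule rec_succ[where T = "Pow N"]) (simp_all add: typed_iff numeral_2_eq_2 numeral_3_eq_3)
  also have "\<Gamma> \<turnstile> Lam N (Lam (Pow N) ?t) \<cdot> n \<cdot> cell f n \<approx> Lam N ?u"
    using beta2[of "Pow N" N ?t "Pow N" n "cell f n" \<Gamma>]
    by (simp add: typed_iff numeral_2_eq_2 numeral_3_eq_3)
  finally have "\<Gamma> \<turnstile> cell f (Succ n) \<cdot> b \<approx> Lam N ?u \<cdot> b"
    by (rule eq_App[OF _ eq_refl[OF b], where T = N and U = Om]) (simp_all add: typed_iff)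
  then have "\<Gamma> \<turnstile> cell f (Succ n) \<cdot> b \<longleftrightarrow> \<Gamma> \<turnstile> Lam N ?u \<cdot> b"
    by (rule eq_iff) (simp add: typed_iff)
  then show ?thesis
    by (subst (asm) beta_iff[OF _ b]) (simp_all add: typed_iff)
qed

lemma cell_left:
  assumes n: "typed [] n N" and a: "typed [] a N" and cell: "\<Gamma> \<turnstile> cell f n \<cdot> a" and test: "\<Gamma> \<turnstile> goes_left f n a"
  shows "\<Gamma> \<turnstile> cell f (Succ n) \<cdot> triple a"
proof -
  note [simp] = closedD[OF n] closedD[OF a]
  show ?thesis
    unfolding cell_Succ[OF n typed_triple[OF a]]
    by (rule existsI[OF _ a])
      (use cell test in \<open>simp_all add: typed_iff conjI disjI1 eq_refl\<close>)
qed

lemma cell_right: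
  assumes n: "typed [] n N" and a: "typed [] a N" and cell: "\<Gamma> \<turnstile> cell f n \<cdot> a"
    and test: "\<Gamma> \<turnstile> \<^bold>\<not> goes_left f n a"
  shows "\<Gamma> \<turnstile> cell f (Succ n) \<cdot> Succ (Succ (triple a))"
proof -
  note [simp] = closedD[OF n] closedD[OF a]
  have b: "typed [] (Succ (Succ (triple a))) N"
    by (intro typed_nat a)
  show ?thesis
    unfolding cell_Succ[OF n b]
    by (rule existsI[OF _ a])
      (use cell test in \<open>simp_all add: typed_iff conjI disjI2 eq_refl\<close>)
qed

lemma cell_SuccE:
  assumes n: "typed [] n N" and b: "typed [] b N" and cell: "\<Gamma> \<turnstile> cell f (Succ n) \<cdot> b"
    and left: "\<And>\<Delta> a. \<Gamma> \<sqsubseteq> \<Delta> \<Longrightarrow> typed [] a N \<Longrightarrow> \<Delta> \<turnstile> cell f n \<cdot> a \<Longrightarrow> \<Delta> \<turnstile> goes_left f n a \<Longrightarrow>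
      \<Delta> \<turnstile> b \<approx> triple a \<Longrightarrow> \<Delta> \<turnstile> \<psi>"
    and right: "\<And>\<Delta> a. \<Gamma> \<sqsubseteq> \<Delta> \<Longrightarrow> typed [] a N \<Longrightarrow> \<Delta> \<turnstile> cell f n \<cdot> a \<Longrightarrow> \<Delta> \<turnstile> \<^bold>\<not> goes_left f n a \<Longrightarrow>
      \<Delta> \<turnstile> b \<approx> Succ (Succ (triple a)) \<Longrightarrow> \<Delta> \<turnstile> \<psi>"
  shows "\<Gamma> \<turnstile> \<psi>"
proof (rule exists_elim[OF cell[unfolded cell_Succ[OF n b]]], goal_cases)
  case (1 \<Delta> a)
  note [simp] = closedD[OF n] closedD[OF b] closedD[OF 1(2)]
  have conj: "\<Delta> \<turnstile> cell f n \<cdot> a \<^bold>\<and> (goes_left f n a \<^bold>\<and> b \<approx> triple a \<^bold>\<or> \<^bold>\<not> goes_left f n a \<^bold>\<and> b \<approx> Succ (Succ (triple a)))"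
    using 1(3) by simp
  show ?case
  proof (rule disj_elim[OF conjE2[OF conj]])
    fix \<Theta> assume \<Theta>: "\<Delta> \<sqsubseteq> \<Theta>" and *: "\<Theta> \<turnstile> goes_left f n a \<^bold>\<and> b \<approx> triple a"
    show "\<Theta> \<turnstile> \<psi>"
      by (rule left[OF weaker_trans[OF 1(1) \<Theta>] 1(2) weakening[OF conjE1[OF conj] \<Theta>] conjE1[OF *] conjE2[OF *]])
  next
    fix \<Theta> assume \<Theta>: "\<Delta> \<sqsubseteq> \<Theta>" and *: "\<Theta> \<turnstile> \<^bold>\<not> goes_left f n a \<^bold>\<and> b \<approx> Succ (Succ (triple a))"
    show "\<Theta> \<turnstile> \<psi>"
      by (rule right[OF weaker_trans[OF 1(1) \<Theta>] 1(2) weakening[OF conjE1[OF conj] \<Theta>] conjE1[OF *] conjE2[OF *]])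
  qed
qed

text \<open>
  The interval of stage \<open>n\<close> may be used in the proof of a contradiction. This is the double negation
  of its existence, proved by induction: if stage \<open>m + 1\<close> is empty, then the test at an interval of
  stage \<open>m\<close> can neither succeed nor fail.
\<close>

lemma cell_exists:
  assumes n: "typed [] n N"
    and step: "\<And>\<Delta> a. \<Gamma> \<sqsubseteq> \<Delta> \<Longrightarrow> typed [] a N \<Longrightarrow> \<Delta> \<turnstile> cell f n \<cdot> a \<Longrightarrow> \<Delta> \<turnstile> Falsum"
  shows "\<Gamma> \<turnstile> Falsum"
proof -
  let ?\<phi> = "\<^bold>\<not> Forall N (\<^bold>\<not> (cell f (Bound 1) \<cdot> Bound 0))"
  have "\<Gamma> \<turnstile> ?\<phi>\<lbrakk>n\<rbrakk>"
  proof (rule induct_nat)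
    have one: "typed [] (Succ Zero) N"
      by (intro typed_nat)
    have "\<Delta> \<turnstile> Falsum" if none: "\<Delta> \<turnstile> Forall N (\<^bold>\<not> (cell f Zero \<cdot> Bound 0))" for \<Delta>
    proof (rule implE)
      show "\<Delta> \<turnstile> \<^bold>\<not> (cell f Zero \<cdot> Succ Zero)"
        using forallE[OF none one] by simp
      show "\<Delta> \<turnstile> cell f Zero \<cdot> Succ Zero"
        unfolding cell_Zero[OF one] by (rule eq_refl[OF one])
    qed
    then have "\<Gamma> \<turnstile> \<^bold>\<not> Forall N (\<^bold>\<not> (cell f Zero \<cdot> Bound 0))"
      by (intro impl_intro) (simp_all add: typed_iff)
    then show "\<Gamma> \<turnstile> ?\<phi>\<lbrakk>Zero\<rbrakk>"
      by simp
  next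
    fix \<Delta> m assume m: "typed [] m N" and "\<Delta> \<turnstile> ?\<phi>\<lbrakk>m\<rbrakk>"
    note [simp] = closedD[OF m]
    then have IH: "\<Delta> \<turnstile> \<^bold>\<not> Forall N (\<^bold>\<not> (cell f m \<cdot> Bound 0))"
      using \<open>\<Delta> \<turnstile> ?\<phi>\<lbrakk>m\<rbrakk>\<close> by simp
    have "\<Theta> \<turnstile> Falsum" if \<Theta>: "\<Delta> \<sqsubseteq> \<Theta>" and none: "\<Theta> \<turnstile> Forall N (\<^bold>\<not> (cell f (Succ m) \<cdot> Bound 0))" for \<Theta>
    proof (rule implE[OF weakening[OF IH \<Theta>]], rule forall_impl_intro, goal_cases)
      case (3 \<Lambda> a)
      have a: "typed [] a N" and cell: "\<Lambda> \<turnstile> cell f m \<cdot> a"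
        using 3 by simp_all
      note [simp] = closedD[OF a]
      have no: "\<Lambda>' \<turnstile> Falsum" if "\<Lambda> \<sqsubseteq> \<Lambda>'" "\<Lambda>' \<turnstile> cell f (Succ m) \<cdot> b" "typed [] b N" for \<Lambda>' b
        using forall_impl_elim[OF weakening[OF none weaker_trans[OF 3(1) that(1)]] that(3)] that(2) by simp
      have not_left: "\<Lambda> \<turnstile> \<^bold>\<not> goes_left f m a"
      proof (rule impl_intro)
        fix \<Lambda>' assume \<Lambda>': "\<Lambda> \<sqsubseteq> \<Lambda>'" and "\<Lambda>' \<turnstile> goes_left f m a"
        then show "\<Lambda>' \<turnstile> Falsum"
          by (intro no[OF \<Lambda>' cell_left[OF m a weakening[OF cell \<Lambda>']]] typed_nat a)
      qed (simp add: typed_iff)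
      have "\<Lambda> \<turnstile> Falsum"
        by (intro no[OF weaker_refl cell_right[OF m a cell not_left]] typed_nat a)
      then show ?case by simp
    qed (simp_all add: typed_iff)
    then have "\<Delta> \<turnstile> \<^bold>\<not> Forall N (\<^bold>\<not> (cell f (Succ m) \<cdot> Bound 0))"
      by (intro impl_intro) (simp_all add: typed_iff)
    then show "\<Delta> \<turnstile> ?\<phi>\<lbrakk>Succ m\<rbrakk>"
      by simp
  qed (use n in \<open>simp_all add: typed_iff\<close>)
  note [simp] = closedD[OF n]
  have "\<Gamma> \<turnstile> \<^bold>\<not> Forall N (\<^bold>\<not> (cell f n \<cdot> Bound 0))"
    using \<open>\<Gamma> \<turnstile> ?\<phi>\<lbrakk>n\<rbrakk>\<close> by simp
  then show ?thesis
    by (rule implE, intro forall_impl_intro) (use step in \<open>simp_all add: typed_iff\<close>)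
qed

text \<open>
  Two intervals of stage \<open>m + 1\<close> come from equal intervals of stage \<open>m\<close>, and the test for these cannot
  both succeed and fail.
\<close>

lemma cell_unique:
  assumes n: "typed [] n N" and a: "typed [] a N" and b: "typed [] b N"
    and cells: "\<Gamma> \<turnstile> cell f n \<cdot> a" "\<Gamma> \<turnstile> cell f n \<cdot> b"
  shows "\<Gamma> \<turnstile> a \<approx> b"
proof -
  let ?\<psi> = "\<lambda>n. Forall N (cell f n \<cdot> Bound 0 \<^bold>\<longrightarrow> Forall N (cell f n \<cdot> Bound 0 \<^bold>\<longrightarrow> Bound 1 \<approx> Bound 0))"
  let ?\<phi> = "Forall N (cell f (Bound 1) \<cdot> Bound 0 \<^bold>\<longrightarrow> Forall N (cell f (Bound 2) \<cdot> Bound 0 \<^bold>\<longrightarrow> Bound 1 \<approx> Bound 0))"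
  have \<phi>: "?\<phi>\<lbrakk>m\<rbrakk> = ?\<psi> m" for m
    by simp
  have intro: "\<Delta> \<turnstile> ?\<psi> m" if m: "typed [] m N"
    and eq: "\<And>\<Theta> x y. \<Delta> \<sqsubseteq> \<Theta> \<Longrightarrow> typed [] x N \<Longrightarrow> typed [] y N \<Longrightarrow> \<Theta> \<turnstile> cell f m \<cdot> x \<Longrightarrow> \<Theta> \<turnstile> cell f m \<cdot> y \<Longrightarrow> \<Theta> \<turnstile> x \<approx> y"
    for \<Delta> m
  proof -
    note [simp] = closedD[OF m]
    show ?thesis
    proof (rule forall_impl_intro, goal_cases)
      case (3 \<Theta> x)
      note [simp] = closedD[OF 3(2)]
      have "\<Theta> \<turnstile> Forall N (cell f m \<cdot> Bound 0 \<^bold>\<longrightarrow> x \<approx> Bound 0)"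
      proof (rule forall_impl_intro, goal_cases)
        case (3 \<Lambda> y)
        show ?case
          using eq[OF weaker_trans[OF \<open>\<Delta> \<sqsubseteq> \<Theta>\<close> \<open>\<Theta> \<sqsubseteq> \<Lambda>\<close>] \<open>typed [] x N\<close> \<open>typed [] y N\<close>]
            weakening[OF _ \<open>\<Theta> \<sqsubseteq> \<Lambda>\<close>] \<open>\<Theta> \<turnstile> (cell f m \<cdot> Bound 0)\<lbrakk>x\<rbrakk>\<close> 3(3) by simp
      qed (simp_all add: typed_iff)
      then show ?case by simp
    qed (simp_all add: typed_iff numeral_2_eq_2)
  qed
  have elim: "\<Delta> \<turnstile> x \<approx> y" if m: "typed [] m N" and x: "typed [] x N" and y: "typed [] y N"
    and \<psi>: "\<Delta> \<turnstile> ?\<psi> m" and cx: "\<Delta> \<turnstile> cell f m \<cdot> x" and cy: "\<Delta> \<turnstile> cell f m \<cdot> y" for \<Delta> m x y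
  proof -
    note [simp] = closedD[OF m] closedD[OF x]
    have "\<Delta> \<turnstile> Forall N (cell f m \<cdot> Bound 0 \<^bold>\<longrightarrow> x \<approx> Bound 0)"
      using forall_impl_elim[OF \<psi> x] cx by simp
    from forall_impl_elim[OF this y] cy show ?thesis by simp
  qed
  have "\<Gamma> \<turnstile> ?\<phi>\<lbrakk>n\<rbrakk>"
  proof (rule induct_nat, goal_cases)
    case 3
    show ?case
      unfolding \<phi>
    proof (rule intro)
      fix \<Theta> x y assume x: "typed [] x N" and y: "typed [] y N"
        and "\<Theta> \<turnstile> cell f Zero \<cdot> x" and "\<Theta> \<turnstile> cell f Zero \<cdot> y"
      then show "\<Theta> \<turnstile> x \<approx> y"
        unfolding cell_Zero[OF x] cell_Zero[OF y] by (blast intro: eq_trans eq_sym)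
    qed (intro typed_nat)
  next
    case (4 \<Delta> m)
    have m: "typed [] m N" and IH: "\<Delta> \<turnstile> ?\<psi> m"
      using 4 by (simp_all only: \<phi>)
    show ?case
      unfolding \<phi>
    proof (rule intro)
      fix \<Theta> x y assume \<Theta>: "\<Delta> \<sqsubseteq> \<Theta>" and x: "typed [] x N" and y: "typed [] y N"
        and cx: "\<Theta> \<turnstile> cell f (Succ m) \<cdot> x" and cy: "\<Theta> \<turnstile> cell f (Succ m) \<cdot> y"
      have same: "\<Lambda> \<turnstile> c \<approx> d" if "\<Theta> \<sqsubseteq> \<Lambda>" "typed [] c N" "typed [] d N"
        "\<Lambda> \<turnstile> cell f m \<cdot> c" "\<Lambda> \<turnstile> cell f m \<cdot> d" for \<Lambda> c d
        using elim[OF m that(2,3) weakening[OF IH weaker_trans[OF \<Theta> that(1)]] that(4,5)] .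
      have transfer: "\<Lambda> \<turnstile> goes_left f m d" if "\<Lambda> \<turnstile> c \<approx> d" "\<Lambda> \<turnstile> goes_left f m c" "typed [] c N" for \<Lambda> c d
      proof -
        note [simp] = closedD[OF m]
        show ?thesis
          using rewrite[OF that(1), of "goes_left f m (Bound 0)" N] that(2,3) by (simp add: typed_iff)
      qed
      show "\<Theta> \<turnstile> x \<approx> y"
      proof (rule cell_SuccE[OF m x cx], goal_cases)
        case (1 \<Lambda> c)
        show ?case
        proof (rule cell_SuccE[OF m y weakening[OF cy 1(1)]], goal_cases)
          case L: (1 \<Lambda>' d)
          have "\<Lambda>' \<turnstile> triple c \<approx> triple d"
            by (intro eq_triple same weaker_trans[OF 1(1) L(1)] weakening[OF 1(3) L(1)] L 1)
          then show ?case
            using weakening[OF 1(5) L(1)] L(5) by (blast intro: eq_trans eq_sym)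
        next
          case R: (2 \<Lambda>' d)
          have "\<Lambda>' \<turnstile> c \<approx> d"
            by (intro same weaker_trans[OF 1(1) R(1)] weakening[OF 1(3) R(1)] R 1)
          from implE[OF R(4) transfer[OF this weakening[OF 1(4) R(1)] 1(2)]]
          show ?case
            by (rule falsumE) (use x y in \<open>simp add: typed_iff\<close>)
        qed
      next
        case (2 \<Lambda> c)
        show ?case
        proof (rule cell_SuccE[OF m y weakening[OF cy 2(1)]], goal_cases)
          case L: (1 \<Lambda>' d)
          have "\<Lambda>' \<turnstile> d \<approx> c"
            by (intro same weaker_trans[OF 2(1) L(1)] weakening[OF 2(3) L(1)] L 2)
          from implE[OF weakening[OF 2(4) L(1)] transfer[OF this L(4) L(2)]]
          show ?case
            by (rule falsumE) (use x y in \<open>simp add: typed_iff\<close>)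
        next
          case R: (2 \<Lambda>' d)
          have "\<Lambda>' \<turnstile> Succ (Succ (triple c)) \<approx> Succ (Succ (triple d))"
            by (intro eq_Succ eq_triple same weaker_trans[OF 2(1) R(1)] weakening[OF 2(3) R(1)] typed_nat R 2)
          then show ?case
            using weakening[OF 2(5) R(1)] R(5) by (blast intro: eq_trans eq_sym)
        qed
      qed
    qed (intro typed_nat m)
  qed (use n in \<open>simp_all add: typed_iff numeral_2_eq_2\<close>)
  then show ?thesis
    unfolding \<phi> by (intro elim[OF n a b _ cells])
qed

text \<open>
  By induction on \<open>j\<close>, where the base case is \<open>cell_unique\<close>: without it, an interval of a later
  stage might descend from a different interval of stage \<open>n\<close>.
\<close>

lemma nested:
  assumes n: "typed [] n N" and j: "typed [] j N" and a: "typed [] a N" and b: "typed [] b N"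
    and cells: "\<Gamma> \<turnstile> cell f n \<cdot> a" "\<Gamma> \<turnstile> cell f (n \<^bold>+ j) \<cdot> b"
  shows "\<Gamma> \<turnstile> leq_nat \<cdot> (a \<^bold>* Succ (den_pred (n \<^bold>+ j))) \<cdot> (b \<^bold>* Succ (den_pred n))"
    and "\<Gamma> \<turnstile> leq_nat \<cdot> (Succ b \<^bold>* Succ (den_pred n)) \<cdot> (Succ a \<^bold>* Succ (den_pred (n \<^bold>+ j)))"
proof -
  note [simp] = closedD[OF n] closedD[OF j] closedD[OF a]
  let ?R = "\<lambda>m b. leq_nat \<cdot> (a \<^bold>* Succ (den_pred m)) \<cdot> (b \<^bold>* Succ (den_pred n)) \<^bold>\<and>
    leq_nat \<cdot> (Succ b \<^bold>* Succ (den_pred n)) \<cdot> (Succ a \<^bold>* Succ (den_pred m))"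
  let ?\<psi> = "Forall N (cell f (Bound 1) \<cdot> Bound 0 \<^bold>\<longrightarrow> ?R (Bound 1) (Bound 0))"
  have \<psi>: "typed [N] ?\<psi> Om"
    by (simp add: typed_iff)
  have intro: "\<Delta> \<turnstile> ?\<psi>\<lbrakk>m\<rbrakk>" if m: "typed [] m N"
    and R: "\<And>\<Theta> c. \<Delta> \<sqsubseteq> \<Theta> \<Longrightarrow> typed [] c N \<Longrightarrow> \<Theta> \<turnstile> cell f m \<cdot> c \<Longrightarrow> \<Theta> \<turnstile> ?R m c" for \<Delta> m
  proof -
    note [simp] = closedD[OF m]
    have "\<Delta> \<turnstile> Forall N (cell f m \<cdot> Bound 0 \<^bold>\<longrightarrow> ?R m (Bound 0))"
      by (rule forall_impl_intro) (use R in \<open>simp_all add: typed_iff\<close>)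
    then show ?thesis by simp
  qed
  have elim: "\<Delta> \<turnstile> ?R m c" if m: "typed [] m N" and c: "typed [] c N"
    and "\<Delta> \<turnstile> ?\<psi>\<lbrakk>m\<rbrakk>" and "\<Delta> \<turnstile> cell f m \<cdot> c" for \<Delta> m c
  proof -
    note [simp] = closedD[OF m]
    have "\<Delta> \<turnstile> Forall N (cell f m \<cdot> Bound 0 \<^bold>\<longrightarrow> ?R m (Bound 0))"
      using that(3) by simp
    from forall_impl_elim[OF this c] that(4) show ?thesis by simp
  qed
  have base: "\<Gamma> \<turnstile> ?\<psi>\<lbrakk>n\<rbrakk>"
  proof (rule intro[OF n])
    fix \<Theta> c assume \<Theta>: "\<Gamma> \<sqsubseteq> \<Theta>" and c: "typed [] c N" and cell: "\<Theta> \<turnstile> cell f n \<cdot> c"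
    note typs = typed_nat n a c
    have eq: "\<Theta> \<turnstile> a \<approx> c"
      by (rule cell_unique[OF n a c weakening[OF cells(1) \<Theta>] cell])
    have refl_leq: "\<Theta> \<turnstile> leq_nat \<cdot> s \<cdot> t" if "\<Theta> \<turnstile> t \<approx> s" "typed [] s N" "typed [] t N" for s t
      using that by (intro leq_natI[where k = Zero] eq_trans[OF that(1) eq_sym[OF plus_zero]] typed_nat)
    show "\<Theta> \<turnstile> ?R n c"
      by (intro conjI refl_leq eq_times eq_Succ eq_sym[OF eq] eq eq_refl typs)
  qed
  have "\<Gamma> \<turnstile> ?\<psi>\<lbrakk>n \<^bold>+ j\<rbrakk>"
  proof (rule induct_from[OF \<psi> n j base])
    fix \<Delta> m assume m: "typed [] m N" and IH: "\<Delta> \<turnstile> ?\<psi>\<lbrakk>m\<rbrakk>"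
    show "\<Delta> \<turnstile> ?\<psi>\<lbrakk>Succ m\<rbrakk>"
    proof (rule intro)
      fix \<Theta> c assume \<Theta>: "\<Delta> \<sqsubseteq> \<Theta>" and c: "typed [] c N" and cell: "\<Theta> \<turnstile> cell f (Succ m) \<cdot> c"
      have child: "\<Lambda> \<turnstile> ?R (Succ m) c"
        if "\<Theta> \<sqsubseteq> \<Lambda>" and b: "typed [] b N" and "\<Lambda> \<turnstile> cell f m \<cdot> b" and c_eq: "\<Lambda> \<turnstile> c \<approx> triple b \<^bold>+ i"
          and "cls i + cls i' = 1 + 1" and "typed [] i N" "typed [] i' N" for \<Lambda> b i i'
      proof -
        have "\<Lambda> \<turnstile> ?R m b"
          by (rule elim[OF m b weakening[OF IH weaker_trans[OF \<Theta> that(1)]] that(3)])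
        from nested_step[OF n m a b c that(6,7,5) c_eq conjE1[OF this] conjE2[OF this]]
        show ?thesis
          by (rule conjI)
      qed
      have zero: "typed [] Zero N" and two: "typed [] (Succ (Succ Zero)) N"
        by (intro typed_nat)+
      show "\<Theta> \<turnstile> ?R (Succ m) c"
      proof (rule cell_SuccE[OF m c cell], goal_cases)
        case (1 \<Lambda> b)
        have "\<Lambda> \<turnstile> triple b \<approx> triple b \<^bold>+ Zero"
          by (intro eq_sym[OF plus_zero] typed_nat 1)
        from child[OF 1(1-3) eq_trans[OF 1(5) this] _ zero two] show ?case
          by (simp add: cls_simps typed_nat)
      next
        case (2 \<Lambda> b)
        have "\<Lambda> \<turnstile> Succ (Succ (triple b)) \<approx> triple b \<^bold>+ Succ (Succ Zero)"
          by (rule cls_eq) (simp_all add: cls_simps typed_nat 2 add_ac)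
        from child[OF 2(1-3) eq_trans[OF 2(5) this] _ two zero] show ?case
          by (simp add: cls_simps typed_nat)
      qed
    qed (intro typed_nat m)
  qed
  from conjE1[OF elim[OF typed_plus[OF n j] b this cells(2)]]
    conjE2[OF elim[OF typed_plus[OF n j] b this cells(2)]]
  show "\<Gamma> \<turnstile> leq_nat \<cdot> (a \<^bold>* Succ (den_pred (n \<^bold>+ j))) \<cdot> (b \<^bold>* Succ (den_pred n))"
    and "\<Gamma> \<turnstile> leq_nat \<cdot> (Succ b \<^bold>* Succ (den_pred n)) \<cdot> (Succ a \<^bold>* Succ (den_pred (n \<^bold>+ j)))"
    by blast+
qed

section \<open>The supremum of the left endpoints\<close>

lemma typed_left_ends: "typed [] (left_ends f) (Pow Q)"
  by (simp add: left_ends_def typed_iff numeral_2_eq_2)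

lemma typed_ends: "typed [] n N \<Longrightarrow> typed [] a N \<Longrightarrow> typed [] (lo n a) Q"
    "typed [] n N \<Longrightarrow> typed [] a N \<Longrightarrow> typed [] (hi n a) Q"
  by (simp_all add: typed_iff)

lemma left_ends_unfold:
  assumes x: "typed [] x Q"
  shows "\<Gamma> \<turnstile> left_ends f \<cdot> x \<longleftrightarrow>
    \<Gamma> \<turnstile> Exists N (Exists N (cell f (Bound 1) \<cdot> Bound 0 \<^bold>\<and> x \<approx> lo (Bound 1) (Bound 0)))"
proof -
  note [simp] = closedD[OF x]
  show ?thesis
    unfolding left_ends_def by (subst beta_iff[OF _ x]) (simp_all add: typed_iff numeral_2_eq_2)
qed

lemma left_endI:
  assumes n: "typed [] n N" and a: "typed [] a N" and cell: "\<Gamma> \<turnstile> cell f n \<cdot> a"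
  shows "\<Gamma> \<turnstile> left_ends f \<cdot> lo n a"
proof -
  note [simp] = closedD[OF n] closedD[OF a]
  have "\<Gamma> \<turnstile> Exists N (cell f n \<cdot> Bound 0 \<^bold>\<and> lo n a \<approx> lo n (Bound 0))"
    by (rule existsI[OF _ a]) (use cell in \<open>simp_all add: typed_iff conjI refl[OF typed_ends(1)[OF n a]]\<close>)
  then show ?thesis
    unfolding left_ends_unfold[OF typed_ends(1)[OF n a]]
    by (intro existsI[OF _ n]) (simp_all add: typed_iff)
qed

lemma left_endE:
  assumes x: "typed [] x Q" and left_end: "\<Gamma> \<turnstile> left_ends f \<cdot> x"
    and step: "\<And>\<Delta> n a. \<Gamma> \<sqsubseteq> \<Delta> \<Longrightarrow> typed [] n N \<Longrightarrow> typed [] a N \<Longrightarrow> \<Delta> \<turnstile> cell f n \<cdot> a \<Longrightarrow>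
      \<Delta> \<turnstile> x \<approx> lo n a \<Longrightarrow> \<Delta> \<turnstile> \<psi>"
  shows "\<Gamma> \<turnstile> \<psi>"
proof (rule exists_elim[OF left_end[unfolded left_ends_unfold[OF x]]], goal_cases)
  case (1 \<Delta> n)
  note [simp] = closedD[OF 1(2)] closedD[OF x]
  have ex: "\<Delta> \<turnstile> Exists N (cell f n \<cdot> Bound 0 \<^bold>\<and> x \<approx> lo n (Bound 0))"
    using 1(3) by simp
  show ?case
  proof (rule exists_elim[OF ex], goal_cases)
    case (1 \<Theta> a)
    have conj: "\<Theta> \<turnstile> cell f n \<cdot> a \<^bold>\<and> x \<approx> lo n a"
      using 1(3) by simp
    show ?case
      by (rule step[OF weaker_trans[OF \<open>\<Gamma> \<sqsubseteq> \<Delta>\<close> 1(1)] \<open>typed [] n N\<close> 1(2) conjE1[OF conj] conjE2[OF conj]])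
  qed
qed

text \<open>
  Both intervals contain an interval of stage \<open>n + m\<close>, which may be assumed to exist because the goal is
  a contradiction. Comparing through it avoids deciding which of \<open>n\<close> and \<open>m\<close> is larger.
\<close>

lemma hi_not_less_lo:
  assumes n: "typed [] n N" and m: "typed [] m N" and a: "typed [] a N" and b: "typed [] b N"
    and cells: "\<Gamma> \<turnstile> cell f n \<cdot> a" "\<Gamma> \<turnstile> cell f m \<cdot> b"
    and less: "\<Gamma> \<turnstile> less_rat \<cdot> hi n a \<cdot> lo m b"
  shows "\<Gamma> \<turnstile> Falsum"
proof (rule cell_exists[OF typed_plus[OF n m]])
  fix \<Delta> z assume \<Delta>: "\<Gamma> \<sqsubseteq> \<Delta>" and z: "typed [] z N" and zcell: "\<Delta> \<turnstile> cell f (n \<^bold>+ m) \<cdot> z"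
  note typs = typed_nat n m a b z
  note [simp] = closedD[OF n] closedD[OF m] closedD[OF a] closedD[OF b] closedD[OF z]
  let ?x = "n \<^bold>+ m"
  have zcell': "\<Delta> \<turnstile> cell f (m \<^bold>+ n) \<cdot> z"
    using rewrite[OF plus_comm[OF n m, of \<Delta>], of "cell f (Bound 0) \<cdot> z" N] zcell
    by (simp add: typed_iff)
  have upper: "\<Delta> \<turnstile> leq_nat \<cdot> (Succ z \<^bold>* Succ (den_pred n)) \<cdot> (Succ a \<^bold>* Succ (den_pred ?x))"
    by (rule nested(2)[OF n m a z weakening[OF cells(1) \<Delta>] zcell])
  have lower: "\<Delta> \<turnstile> leq_nat \<cdot> (b \<^bold>* Succ (den_pred ?x)) \<cdot> (z \<^bold>* Succ (den_pred m))"
    using rewrite[OF plus_comm[OF m n, of \<Delta>],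
        of "leq_nat \<cdot> (b \<^bold>* Succ (den_pred (Bound 0))) \<cdot> (z \<^bold>* Succ (den_pred m))" N]
      nested(1)[OF m n b z weakening[OF cells(2) \<Delta>] zcell']
    by (simp add: typed_iff)
  show "\<Delta> \<turnstile> Falsum"
  proof (rule leq_natE[OF _ _ upper])
    fix \<Theta> v assume \<Theta>: "\<Delta> \<sqsubseteq> \<Theta>" and v: "typed [] v N"
      and v_eq: "\<Theta> \<turnstile> Succ a \<^bold>* Succ (den_pred ?x) \<approx> Succ z \<^bold>* Succ (den_pred n) \<^bold>+ v"
    show "\<Theta> \<turnstile> Falsum"
    proof (rule leq_natE[OF _ _ weakening[OF lower \<Theta>]])
      fix \<Lambda> u assume \<Lambda>: "\<Theta> \<sqsubseteq> \<Lambda>" and u: "typed [] u N"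
        and u_eq: "\<Lambda> \<turnstile> z \<^bold>* Succ (den_pred m) \<approx> b \<^bold>* Succ (den_pred ?x) \<^bold>+ u"
      have "\<Lambda> \<turnstile> less_rat \<cdot> frac (Succ a) (den_pred n) \<cdot> frac b (den_pred m)"
        using weakening[OF less weaker_trans[OF \<Delta> weaker_trans[OF \<Theta> \<Lambda>]]] by (simp add: hi_def lo_def)
      then show "\<Lambda> \<turnstile> Falsum"
      proof (rule less_frac_elim)
        fix \<Xi> k assume \<Xi>: "\<Lambda> \<sqsubseteq> \<Xi>" and k: "typed [] k N"
          and k_eq: "\<Xi> \<turnstile> b \<^bold>* Succ (den_pred n) \<approx> Succ a \<^bold>* Succ (den_pred m) \<^bold>+ Succ k"
        note typs = typs u v k
        let ?zmn = "z \<^bold>* Succ (den_pred m) \<^bold>* Succ (den_pred n)"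
        let ?rest = "Succ k \<^bold>* Succ (den_pred ?x) \<^bold>+ u \<^bold>* Succ (den_pred n)"
        let ?gap = "den_pred n \<^bold>* Succ (den_pred m) \<^bold>+ den_pred m \<^bold>+ v \<^bold>* Succ (den_pred m) \<^bold>+ ?rest"
        have "\<Xi> \<turnstile> ?zmn \<approx> (b \<^bold>* Succ (den_pred ?x) \<^bold>+ u) \<^bold>* Succ (den_pred n)"
          by (rule eq_times[OF weakening[OF u_eq \<Xi>] eq_refl]) (intro typs)+
        also have "\<Xi> \<turnstile> (b \<^bold>* Succ (den_pred ?x) \<^bold>+ u) \<^bold>* Succ (den_pred n)
            \<approx> b \<^bold>* Succ (den_pred n) \<^bold>* Succ (den_pred ?x) \<^bold>+ u \<^bold>* Succ (den_pred n)"
          by (rule cls_eq) (simp_all add: cls_simps typs algebra_simps)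
        also have "\<Xi> \<turnstile> b \<^bold>* Succ (den_pred n) \<^bold>* Succ (den_pred ?x) \<^bold>+ u \<^bold>* Succ (den_pred n)
            \<approx> (Succ a \<^bold>* Succ (den_pred m) \<^bold>+ Succ k) \<^bold>* Succ (den_pred ?x) \<^bold>+ u \<^bold>* Succ (den_pred n)"
          by (rule eq_plus[OF eq_times[OF k_eq eq_refl] eq_refl]) (intro typs)+
        also have "\<Xi> \<turnstile> (Succ a \<^bold>* Succ (den_pred m) \<^bold>+ Succ k) \<^bold>* Succ (den_pred ?x) \<^bold>+ u \<^bold>* Succ (den_pred n)
            \<approx> Succ a \<^bold>* Succ (den_pred ?x) \<^bold>* Succ (den_pred m) \<^bold>+ ?rest"
          by (rule cls_eq) (simp_all add: cls_simps typs algebra_simps)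
        also have "\<Xi> \<turnstile> Succ a \<^bold>* Succ (den_pred ?x) \<^bold>* Succ (den_pred m) \<^bold>+ ?rest
            \<approx> (Succ z \<^bold>* Succ (den_pred n) \<^bold>+ v) \<^bold>* Succ (den_pred m) \<^bold>+ ?rest"
          by (rule eq_plus[OF eq_times[OF weakening[OF v_eq weaker_trans[OF \<Lambda> \<Xi>]] eq_refl] eq_refl])
            (intro typs)+
        also have "\<Xi> \<turnstile> (Succ z \<^bold>* Succ (den_pred n) \<^bold>+ v) \<^bold>* Succ (den_pred m) \<^bold>+ ?rest \<approx> ?zmn \<^bold>+ Succ ?gap"
          by (rule cls_eq) (simp_all add: cls_simps typs algebra_simps)
        finally show "\<Xi> \<turnstile> Falsum"
          by (rule no_self_plus) (intro typs)+
      qed (intro typs)+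
    qed (intro typs)+
  qed (intro typs)+
qed

lemma hi_upper_bound:
  assumes n: "typed [] n N" and a: "typed [] a N" and cell: "\<Gamma> \<turnstile> cell f n \<cdot> a"
  shows "\<Gamma> \<turnstile> upper_bound (left_ends f) (hi n a)"
proof (rule upper_boundI[OF typed_left_ends typed_ends(2)[OF n a]])
  fix \<Delta> x assume \<Delta>: "\<Gamma> \<sqsubseteq> \<Delta>" and x: "typed [] x Q" and left_end: "\<Delta> \<turnstile> left_ends f \<cdot> x"
    and less: "\<Delta> \<turnstile> less_rat \<cdot> hi n a \<cdot> x"
  show "\<Delta> \<turnstile> Falsum"
  proof (rule left_endE[OF x left_end])
    fix \<Theta> m b assume \<Theta>: "\<Delta> \<sqsubseteq> \<Theta>" and m: "typed [] m N" and b: "typed [] b N"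
      and cell': "\<Theta> \<turnstile> cell f m \<cdot> b" and eq: "\<Theta> \<turnstile> x \<approx> lo m b"
    note [simp] = closedD[OF n] closedD[OF a]
    have "\<Theta> \<turnstile> less_rat \<cdot> hi n a \<cdot> lo m b"
      using rewrite[OF eq, of "less_rat \<cdot> hi n a \<cdot> Bound 0" Q] weakening[OF less \<Theta>] x
      by (simp add: typed_iff)
    then show "\<Theta> \<turnstile> Falsum"
      by (rule hi_not_less_lo[OF n m a b weakening[OF cell weaker_trans[OF \<Delta> \<Theta>]] cell'])
  qed
qed

lemma macneille_left_ends: "\<Gamma> \<turnstile> macneille_real \<cdot> supremum (left_ends f)"
proof -
  have typs: "typed [] Zero N" "typed [] (Succ Zero) N" "typed [] (den_pred Zero) N"
    "typed [] (Succ (Succ Zero)) N" "typed [] (Succ (Succ (Succ Zero))) N"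
    by (intro typed_nat)+
  have cell: "\<Gamma> \<turnstile> cell f Zero \<cdot> Succ Zero"
    unfolding cell_Zero[OF typs(2)] by (rule eq_refl[OF typs(2)])
  have below: "\<Gamma> \<turnstile> less_rat \<cdot> frac Zero Zero \<cdot> lo Zero (Succ Zero)"
    unfolding lo_def
    by (rule less_frac_intro[where k = Zero], rule cls_eq) (simp_all add: cls_simps typed_nat)
  have above: "\<Gamma> \<turnstile> less_rat \<cdot> hi Zero (Succ Zero) \<cdot> frac (Succ (Succ (Succ Zero))) (den_pred Zero)"
    unfolding hi_def
    by (rule less_frac_intro[where k = "den_pred Zero"], rule cls_eq)
      (simp_all add: cls_simps typed_nat algebra_simps)
  show ?thesis
    by (rule macneille_supremum[OF typed_left_ends _ typed_ends(1)[OF typs(1,2)] typed_ends(2)[OF typs(1,2)] _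
          left_endI[OF typs(1,2) cell] below hi_upper_bound[OF typs(1,2) cell] above])
      (simp_all add: typed_iff)
qed

text \<open>
  Let \<open>c\<close> be the endpoint tested at the interval of stage \<open>n\<close>. If the test succeeds, \<open>c\<close> is the right
  endpoint of the next interval, hence an upper bound of the left endpoints and not in the lower set of their
  supremum; but the supremum is the \<open>n\<close>-th value of \<open>f\<close>, whose lower set contains \<open>c\<close>. So the test
  fails. Then \<open>c\<close> is below a left endpoint, hence in the lower set of the supremum, and the test succeeds.
\<close>

lemma supremum_not_in_range:
  assumes n: "typed [] n N" and eq: "\<Gamma> \<turnstile> f \<cdot> n \<approx> supremum (left_ends f)"
  shows "\<Gamma> \<turnstile> Falsum"
proof (rule cell_exists[OF n])
  fix \<Delta> a assume \<Delta>: "\<Gamma> \<sqsubseteq> \<Delta>" and a: "typed [] a N" and cell: "\<Delta> \<turnstile> cell f n \<cdot> a"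
  note [simp] = closedD[OF n] closedD[OF a]
  let ?c = "hi (Succ n) (triple a)" and ?d = "lo (Succ n) (Succ (Succ (triple a)))"
  have typs: "typed [] (Succ n) N" "typed [] (triple a) N" "typed [] (Succ (Succ (triple a))) N"
    by (intro typed_nat n a)+
  note c = typed_ends(2)[OF typs(1,2)] and d = typed_ends(1)[OF typs(1,3)]
  have fn: "typed [] (f \<cdot> n) Cut"
    by (simp add: typed_iff)
  have test: "\<Theta> \<turnstile> goes_left f n a \<longleftrightarrow> \<Theta> \<turnstile> Fst (supremum (left_ends f)) \<cdot> ?c" if "\<Delta> \<sqsubseteq> \<Theta>" for \<Theta>
    unfolding goes_left_def
    by (rule eq_iff[OF eq_App[OF eq_Fst[OF weakening[OF eq weaker_trans[OF \<Delta> that]] fn] refl[OF c] _ c]])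
      (simp_all add: typed_iff)
  have not_left: "\<Delta> \<turnstile> \<^bold>\<not> goes_left f n a"
  proof (rule impl_intro)
    fix \<Theta> assume \<Theta>: "\<Delta> \<sqsubseteq> \<Theta>" and left: "\<Theta> \<turnstile> goes_left f n a"
    show "\<Theta> \<turnstile> Falsum"
      by (rule upper_bound_not_lower[OF typed_left_ends c left[unfolded test[OF \<Theta>]]
            hi_upper_bound[OF typs(1,2) cell_left[OF n a weakening[OF cell \<Theta>] left]]])
  qed (simp add: typed_iff)
  have less: "\<Delta> \<turnstile> less_rat \<cdot> ?c \<cdot> ?d"
    unfolding lo_def hi_def
    by (rule less_frac_intro[where k = "den_pred (Succ n)"], rule cls_eq)
      (simp_all add: cls_simps cls_triple typed_nat n a algebra_simps)
  have "\<Delta> \<turnstile> Fst (supremum (left_ends f)) \<cdot> ?c"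
    by (rule below_element_lower[OF typed_left_ends c d
          left_endI[OF typs(1,3) cell_right[OF n a cell not_left]] less])
  then show "\<Delta> \<turnstile> Falsum"
    unfolding test[OF weaker_refl, symmetric] by (rule implE[OF not_left])
qed

end

theorem mainTheorem1:
  shows "[] \<turnstile>
    all ''f'' (N \<rightarrow>\<^sub>t Cut) (\<lambda>f.
      all ''n'' N (\<lambda>n. macneille_real \<cdot> (f \<cdot> n)) \<^bold>\<longrightarrow>
      ex ''x0'' Cut (\<lambda>x0. macneille_real \<cdot> x0 \<^bold>\<and>
        \<^bold>\<not> ex ''n0'' N (\<lambda>n0. f \<cdot> n0 \<approx> x0)))"
proof -
  let ?ex = "\<lambda>f. Exists Cut (macneille_real \<cdot> Bound 0 \<^bold>\<and> \<^bold>\<not> Exists N (f \<cdot> Bound 0 \<approx> Bound 1))"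
  have ex: "\<Gamma> \<turnstile> ?ex f" if f: "typed [] f (N \<rightarrow>\<^sub>t Cut)" for f \<Gamma>
  proof -
    let ?s = "supremum (left_ends f)"
    have s: "typed [] ?s Cut"
      by (rule typed_supremum(3)[OF typed_left_ends[OF f]])
    note [simp] = closedD[OF f] closedD[OF s]
    have "\<Gamma> \<turnstile> \<^bold>\<not> Exists N (f \<cdot> Bound 0 \<approx> ?s)"
    proof (rule impl_intro)
      fix \<Delta> assume ex: "\<Delta> \<turnstile> Exists N (f \<cdot> Bound 0 \<approx> ?s)"
      show "\<Delta> \<turnstile> Falsum"
        by (rule exists_elim[OF ex]) (use supremum_not_in_range[OF f] in simp)
    qed (simp add: typed_iff)
    then show ?thesis
      by (intro existsI[OF _ s]) (simp_all add: typed_iff conjI macneille_left_ends[OF f])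
  qed
  have "[] \<turnstile> Forall (N \<rightarrow>\<^sub>t Cut) (Forall N (macneille_real \<cdot> (Bound 1 \<cdot> Bound 0)) \<^bold>\<longrightarrow>
      Exists Cut (macneille_real \<cdot> Bound 0 \<^bold>\<and> \<^bold>\<not> Exists N (Bound 2 \<cdot> Bound 0 \<approx> Bound 1)))"
    by (rule forall_impl_intro) (use ex in \<open>simp_all add: typed_iff numeral_2_eq_2\<close>)
  then show ?thesis
    by (simp add: binder_defs numeral_2_eq_2)
qed

end
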